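(* The set $\mathfrak{B}_{\mathbb{H}}$ of badly approximable quaternions is null with full Hausdorff dimension, i.e. $|\mathfrak{B}_{\mathbb{H}}|=0$ and $\dim_{\mathrm H}(\mathfrak{B}_{\mathbb{H}})=4$.
   Context: $\mathbb{H}$ denotes the real quaternions $\xi=a+bi+cj+dk$, identified with $\mathbb{R}^4$, with Euclidean norm $|\xi|_2=(a^2+b^2+c^2+d^2)^{1/2}$ and $4$-dimensional Lebesgue measure $|\cdot|$. The Hurwitz integers $\mathcal{H}$ are the quaternions $a+bi+cj+dk$ with either all of $a,b,c,d\in\mathbb{Z}$ or all of $a,b,c,d\in\mathbb{Z}+\frac12$. A quaternion $\xi$ is badly approximable if there is a constant $c>0$ (depending on $\xi$) such that $|\xi-\mathbf{p}\mathbf{q}^{-1}|_2\ge c/|\mathbf{q}|_2^2$ for all $\mathbf{p},\mathbf{q}\in\mathcal{H}$ with $\mathbf{q}\neq0$; $\mathfrak{B}_{\mathbb{H}}$ is the set of all badly approximable quaternions. $\dim_{\mathrm H}$ denotes Hausdorff dimension. *)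

theory Defs
  imports "HOL-Analysis.Analysis"
begin

section \<open>Quaternions\<close>

datatype quat = Quat (Re0: real) (Im1: real) (Im2: real) (Im3: real)

lemma quat_eq_iff:
  "x = y \<longleftrightarrow> Re0 x = Re0 y \<and> Im1 x = Im1 y \<and> Im2 x = Im2 y \<and> Im3 x = Im3 y"
  by (cases x; cases y) simp

instantiation quat :: ab_group_add
begin

definition zero_quat_def: "0 = Quat 0 0 0 0"
definition plus_quat_def:
  "x + y = Quat (Re0 x + Re0 y) (Im1 x + Im1 y) (Im2 x + Im2 y) (Im3 x + Im3 y)"
definition uminus_quat_def: "- x = Quat (- Re0 x) (- Im1 x) (- Im2 x) (- Im3 x)"
definition minus_quat_def:
  "x - y = Quat (Re0 x - Re0 y) (Im1 x - Im1 y) (Im2 x - Im2 y) (Im3 x - Im3 y)"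

instance
  by standard
    (simp_all add: quat_eq_iff zero_quat_def plus_quat_def uminus_quat_def minus_quat_def)

end

lemma quat_zero_sel [simp]: "Re0 0 = 0" "Im1 0 = 0" "Im2 0 = 0" "Im3 0 = 0"
  by (simp_all add: zero_quat_def)

lemma quat_add_sel [simp]:
  "Re0 (x + y) = Re0 x + Re0 y" "Im1 (x + y) = Im1 x + Im1 y"
  "Im2 (x + y) = Im2 x + Im2 y" "Im3 (x + y) = Im3 x + Im3 y"
  by (simp_all add: plus_quat_def)

lemma quat_uminus_sel [simp]:
  "Re0 (- x) = - Re0 x" "Im1 (- x) = - Im1 x" "Im2 (- x) = - Im2 x" "Im3 (- x) = - Im3 x"
  by (simp_all add: uminus_quat_def)

lemma quat_minus_sel [simp]:
  "Re0 (x - y) = Re0 x - Re0 y" "Im1 (x - y) = Im1 x - Im1 y"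
  "Im2 (x - y) = Im2 x - Im2 y" "Im3 (x - y) = Im3 x - Im3 y"
  by (simp_all add: minus_quat_def)

instantiation quat :: real_vector
begin

definition scaleR_quat_def: "r *\<^sub>R x = Quat (r * Re0 x) (r * Im1 x) (r * Im2 x) (r * Im3 x)"

instance
  by standard (simp_all add: quat_eq_iff scaleR_quat_def algebra_simps)

end

lemma quat_scaleR_sel [simp]:
  "Re0 (r *\<^sub>R x) = r * Re0 x" "Im1 (r *\<^sub>R x) = r * Im1 x"
  "Im2 (r *\<^sub>R x) = r * Im2 x" "Im3 (r *\<^sub>R x) = r * Im3 x"
  by (simp_all add: scaleR_quat_def)

instantiation quat :: real_inner
begin

definition inner_quat_def:
  "inner x y = Re0 x * Re0 y + Im1 x * Im1 y + Im2 x * Im2 y + Im3 x * Im3 y"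
definition norm_quat_def:
  "norm x = sqrt ((Re0 x)\<^sup>2 + (Im1 x)\<^sup>2 + (Im2 x)\<^sup>2 + (Im3 x)\<^sup>2)"
definition sgn_quat_def: "sgn (x::quat) = x /\<^sub>R norm x"
definition dist_quat_def: "dist x y = norm (x - y :: quat)"
definition uniformity_quat_def:
  "(uniformity :: (quat \<times> quat) filter) = (INF e\<in>{0<..}. principal {(x, y). dist x y < e})"
definition open_quat_def:
  "open (U :: quat set) \<longleftrightarrow> (\<forall>x\<in>U. eventually (\<lambda>(x', y). x' = x \<longrightarrow> y \<in> U) uniformity)"

instance
proof
  fix x y z :: quat and r :: real and U :: "quat set"
  show "dist x y = norm (x - y)" by (rule dist_quat_def)
  show "sgn x = x /\<^sub>R norm x" by (rule sgn_quat_def)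
  show "(uniformity :: (quat \<times> quat) filter) = (INF e\<in>{0<..}. principal {(x, y). dist x y < e})"
    by (rule uniformity_quat_def)
  show "open U \<longleftrightarrow> (\<forall>x\<in>U. eventually (\<lambda>(x', y). x' = x \<longrightarrow> y \<in> U) uniformity)"
    by (rule open_quat_def)
  show "inner x y = inner y x" by (simp add: inner_quat_def mult.commute)
  show "inner (x + y) z = inner x z + inner y z" by (simp add: inner_quat_def algebra_simps)
  show "inner (r *\<^sub>R x) y = r * inner x y" by (simp add: inner_quat_def algebra_simps)
  show "0 \<le> inner x x" by (simp add: inner_quat_def)
  show "inner x x = 0 \<longleftrightarrow> x = 0"
    by (auto simp: inner_quat_def quat_eq_iff add_nonneg_eq_0_iff)
  show "norm x = sqrt (inner x x)" by (simp add: norm_quat_def inner_quat_def power2_eq_square)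
qed

end

instantiation quat :: euclidean_space
begin

definition Basis_quat_def:
  "Basis = {Quat 1 0 0 0, Quat 0 1 0 0, Quat 0 0 1 0, Quat 0 0 0 1}"

instance
proof
  fix u v x :: quat
  show "Basis \<noteq> ({} :: quat set)" "finite (Basis :: quat set)"
    by (simp_all add: Basis_quat_def)
  show "inner u v = (if u = v then 1 else 0)" if "u \<in> Basis" "v \<in> Basis"
    using that unfolding Basis_quat_def by (elim insertE emptyE) (simp_all add: inner_quat_def)
  show "(\<forall>u\<in>Basis. inner x u = 0) \<longleftrightarrow> x = 0"
    unfolding quat_eq_iff by (simp add: Basis_quat_def inner_quat_def)
qed

end

lemma DIM_quat [simp]: "DIM(quat) = 4"
  by (simp add: Basis_quat_def)

instantiation quat :: real_normed_div_algebra
begin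

definition one_quat_def: "1 = Quat 1 0 0 0"

definition times_quat_def:
  "x * y = Quat
     (Re0 x * Re0 y - Im1 x * Im1 y - Im2 x * Im2 y - Im3 x * Im3 y)
     (Re0 x * Im1 y + Im1 x * Re0 y + Im2 x * Im3 y - Im3 x * Im2 y)
     (Re0 x * Im2 y - Im1 x * Im3 y + Im2 x * Re0 y + Im3 x * Im1 y)
     (Re0 x * Im3 y + Im1 x * Im2 y - Im2 x * Im1 y + Im3 x * Re0 y)"

definition inverse_quat_def:
  "inverse x = Quat (Re0 x) (- Im1 x) (- Im2 x) (- Im3 x) /\<^sub>R (norm x)\<^sup>2"

definition divide_quat_def: "x div y = x * inverse (y :: quat)"

instance
proof
  fix x y z :: quat and r :: real
  show "x * y * z = x * (y * z)" "(x + y) * z = x * z + y * z" "x * (y + z) = x * y + x * z"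
    by (simp_all add: quat_eq_iff times_quat_def algebra_simps)
  have scaleL: "r *\<^sub>R u * v = r *\<^sub>R (u * v)" and scaleR: "u * r *\<^sub>R v = r *\<^sub>R (u * v)"
    for r and u v :: quat
    by (simp_all add: quat_eq_iff times_quat_def algebra_simps)
  show "r *\<^sub>R x * y = r *\<^sub>R (x * y)" "x * r *\<^sub>R y = r *\<^sub>R (x * y)"
    by (rule scaleL scaleR)+
  show "1 * x = x" "x * 1 = x" "(0::quat) \<noteq> 1"
    by (simp_all add: quat_eq_iff times_quat_def one_quat_def)
  have n: "(norm u)\<^sup>2 = (Re0 u)\<^sup>2 + (Im1 u)\<^sup>2 + (Im2 u)\<^sup>2 + (Im3 u)\<^sup>2" for u :: quat
    by (simp add: norm_quat_def)
  show "x div y = x * inverse y" by (rule divide_quat_def)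
  show "inverse (0::quat) = 0" by (simp add: inverse_quat_def)
  show "norm (x * y) = norm x * norm y"
  proof (rule power2_eq_imp_eq)
    show "(norm (x * y))\<^sup>2 = (norm x * norm y)\<^sup>2"
      unfolding power_mult_distrib n times_quat_def quat.sel
      by (simp only: power2_eq_square) (simp only: algebra_simps)
  qed auto
  assume "x \<noteq> 0"
  then have "(norm x)\<^sup>2 \<noteq> 0"
    by simp
  moreover have "Quat (Re0 x) (- Im1 x) (- Im2 x) (- Im3 x) * x = (norm x)\<^sup>2 *\<^sub>R 1"
    "x * Quat (Re0 x) (- Im1 x) (- Im2 x) (- Im3 x) = (norm x)\<^sup>2 *\<^sub>R 1"
    unfolding n by (simp_all add: quat_eq_iff times_quat_def one_quat_def power2_eq_square)
  ultimately show "inverse x * x = 1" "x * inverse x = 1"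
    by (simp_all add: inverse_quat_def scaleL scaleR)
qed

end


section \<open>Badly approximable quaternions\<close>

definition Hurwitz :: "quat set" where
  "Hurwitz =
     {q. (Re0 q \<in> \<int> \<and> Im1 q \<in> \<int> \<and> Im2 q \<in> \<int> \<and> Im3 q \<in> \<int>) \<or>
         (Re0 q - 1/2 \<in> \<int> \<and> Im1 q - 1/2 \<in> \<int> \<and> Im2 q - 1/2 \<in> \<int> \<and> Im3 q - 1/2 \<in> \<int>)}"

definition badly_approximable :: "quat \<Rightarrow> bool" where
  "badly_approximable \<xi> \<longleftrightarrow>
     (\<exists>c>0. \<forall>p\<in>Hurwitz. \<forall>q\<in>Hurwitz. q \<noteq> 0 \<longrightarrow> norm (\<xi> - p * inverse q) \<ge> c / (norm q)\<^sup>2)"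


section \<open>Hausdorff dimension\<close>

text \<open>
  The contribution of one covering set to the \<open>s\<close>-dimensional sum, for bounded sets.
  The case \<open>s = 0\<close> is separate because \<open>0 powr 0 = 0\<close> in the library, whereas a nonempty
  set of diameter \<open>0\<close> has to count \<open>1\<close> for counting measure to result.
\<close>
definition diam_powr :: "real \<Rightarrow> 'a::metric_space set \<Rightarrow> ennreal" where
  "diam_powr s U =
     (if U = {} then 0 else if s = 0 then 1 else ennreal (diameter U powr s))"

text \<open>
  Boundedness is required explicitly, because \<open>diameter\<close> is unspecified on unbounded sets.
  Empty covering sets are allowed, so finite covers are included.
\<close>
definition delta_covers :: "real \<Rightarrow> 'a::metric_space set \<Rightarrow> (nat \<Rightarrow> 'a set) set" where
  "delta_covers \<delta> A = {U. A \<subseteq> (\<Union>i. U i) \<and> (\<forall>i. bounded (U i) \<and> diameter (U i) \<le> \<delta>)}"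

definition hausdorff_premeasure :: "real \<Rightarrow> real \<Rightarrow> 'a::metric_space set \<Rightarrow> ennreal" where
  "hausdorff_premeasure s \<delta> A = (INF U\<in>delta_covers \<delta> A. \<Sum>i. diam_powr s (U i))"

definition hausdorff_outer_measure :: "real \<Rightarrow> 'a::metric_space set \<Rightarrow> ennreal" where
  "hausdorff_outer_measure s A = (SUP \<delta>\<in>{0<..}. hausdorff_premeasure s \<delta> A)"

text \<open>The value is \<open>\<infinity>\<close> if no \<open>s \<ge> 0\<close> gives measure zero.\<close>
definition hausdorff_dim :: "'a::metric_space set \<Rightarrow> ereal" where
  "hausdorff_dim A = (INF s\<in>{s. 0 \<le> s \<and> hausdorff_outer_measure s A = 0}. ereal s)"

end

theory Submission
  imports Defs
begin

text \<open>
  For fixed \<open>c\<close> the set of \<open>\<xi>\<close> with constant \<open>c\<close> is closed and, by Dirichlet's theorem,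
  porous at each of its points at arbitrarily small scales: near \<open>\<xi>\<close> there is \<open>p q\<^sup>-\<^sup>1\<close> at distance
  at most \<open>2 / (N |q|)\<close> with \<open>|q| \<le> 2 N\<close>, and the removed ball of radius \<open>c / |q|\<^sup>2\<close> around it has
  comparable size. A Vitali covering by such balls shows that a porous measurable set is null.

  For the dimension, distinct fractions \<open>p q\<^sup>-\<^sup>1\<close>, \<open>p' q'\<^sup>-\<^sup>1\<close> are at least \<open>1 / (4 |q| |q'|)\<close> apart.
  Dividing cubes of side \<open>M\<^sup>-\<^sup>n\<close> into \<open>M\<^sup>4\<close> children and letting level \<open>n\<close> take care of
  denominators with \<open>|q|\<^sup>2\<close> up to \<open>M\<^sup>n\<^sup>-\<^sup>1 / 16\<close>, each cube sees at most one new fraction and loses at most \<open>4\<^sup>4\<close>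
  children. For \<open>s < 4\<close> and large \<open>M\<close> the remaining \<open>M\<^sup>4 - 256 \<ge> M\<^sup>s\<close> children per cube produce a
  Cantor set of badly approximable points with positive \<open>s\<close>-dimensional measure.
\<close>

section \<open>Porosity, null sets and Hausdorff measure in the top dimension\<close>

lemma emeasure_lebesgue_ball:
  fixes c :: "'a::euclidean_space"
  assumes "r \<ge> 0"
  shows "emeasure lebesgue (ball c r) = ennreal (unit_ball_vol (DIM('a)) * r ^ DIM('a))"
  using assms by (simp add: emeasure_ball)

lemma ennreal_eq_0_if_less:
  fixes x :: ennreal
  assumes "\<And>e::real. e > 0 \<Longrightarrow> x < ennreal e"
  shows "x = 0"
proof (rule ccontr)
  assume "x \<noteq> 0"
  then obtain y where "0 < y" "y < x" using dense[of 0 x] by (auto simp: zero_less_iff_neq_zero)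
  then obtain e where "y = ennreal e" "e > 0"
    by (cases y) (auto simp: ennreal_zero_less_top less_top ennreal_less_iff)
  then show False using assms[of e] \<open>y < x\<close> by auto
qed

text \<open>Disjoint balls inside an open \<open>T\<close> that barely exceeds \<open>S\<close>
  cover almost all of \<open>S\<close>. Each contains a hole with the share
  \<open>k ^ DIM('a)\<close> of its volume, and the holes lie in \<open>T - S\<close>. So this fixed
  share of the measure of \<open>S\<close> is at most the measure of \<open>T - S\<close>, which is
  arbitrarily small.\<close>

lemma porous_null_sets:
  fixes S :: "'a::euclidean_space set"
  assumes S: "S \<in> sets lebesgue" and "k > 0"
    and porous: "\<And>x d. x \<in> S \<Longrightarrow> d > 0 \<Longrightarrow>
      \<exists>r z. 0 < r \<and> r < d \<and> ball z (k * r) \<subseteq> ball x r \<and> ball z (k * r) \<inter> S = {}"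
  shows "S \<in> null_sets lebesgue"
proof -
  define \<theta> where "\<theta> = ennreal (k ^ DIM('a))"
  have \<theta>: "\<theta> \<noteq> 0" "\<theta> \<noteq> top"
    using \<open>k > 0\<close> by (simp_all add: \<theta>_def)
  have "\<theta> * emeasure lebesgue S < ennreal e" if "e > 0" for e
  proof -
    obtain T where T: "open T" "S \<subseteq> T" "T - S \<in> lmeasurable" "emeasure lebesgue (T - S) < ennreal e"
      using sets_lebesgue_outer_open[OF S \<open>e > 0\<close>] .
    define P where "P \<equiv> \<lambda>i z. ball z (k * snd i) \<subseteq> ball (fst i) (snd i) \<and> ball z (k * snd i) \<inter> S = {}"
    \<comment> \<open>Pairs of centre and radius. By porosity the radii at each point of
      \<open>S\<close> are arbitrarily small, as the Vitali covering theorem requires.\<close>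
    define I where "I = {i. fst i \<in> S \<and> 0 < snd i \<and> ball (fst i) (snd i) \<subseteq> T \<and> (\<exists>z. P i z)}"
    define B where "B = (\<lambda>i::'a\<times>real. ball (fst i) (snd i))"
    have "\<exists>i. i \<in> I \<and> x \<in> ball (fst i) (snd i) \<and> snd i < d" if "x \<in> S" "d > 0" for x d
    proof -
      obtain d' where d': "d' > 0" "ball x d' \<subseteq> T" using T \<open>x \<in> S\<close> by (meson openE subsetD)
      obtain r z where r: "0 < r" "r < min d d'" "ball z (k * r) \<subseteq> ball x r" "ball z (k * r) \<inter> S = {}"
        using porous[OF \<open>x \<in> S\<close>, of "min d d'"] d' \<open>d > 0\<close> by auto
      have "ball x r \<subseteq> T" using r d' subset_ball[of r d' x] by auto
      then show ?thesis using r \<open>x \<in> S\<close> by (intro exI[of _ "(x, r)"]) (auto simp: I_def P_def)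
    qed
    then obtain C where C: "countable C" "C \<subseteq> I"
        "pairwise (\<lambda>i j. disjnt (B i) (B j)) C" "negligible (S - (\<Union>i\<in>C. B i))"
      unfolding B_def by (rule Vitali_covering_theorem_balls[of S I fst snd])
    have "\<forall>i\<in>C. \<exists>z. P i z" using C(2) by (auto simp: I_def)
    then obtain z where z: "\<And>i. i \<in> C \<Longrightarrow> P i (z i)" by metis
    define H where "H = (\<lambda>i. ball (z i) (k * snd i))"
    have HB: "H i \<subseteq> B i" "H i \<inter> S = {}" if "i \<in> C" for i
      using z[OF that] by (auto simp: H_def P_def B_def)
    have B: "disjoint_family_on B C"
      using C(3) by (auto simp: disjoint_family_on_def pairwise_def disjnt_def)
    have H: "disjoint_family_on H C"
      unfolding disjoint_family_on_def
    proof (intro ballI impI)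
      fix i j assume ij: "i \<in> C" "j \<in> C" "i \<noteq> j"
      then have "B i \<inter> B j = {}" using B by (simp add: disjoint_family_on_def)
      then show "H i \<inter> H j = {}" using HB(1)[OF ij(1)] HB(1)[OF ij(2)] by blast
    qed
    have BH: "B i \<in> sets lebesgue" "H i \<in> sets lebesgue" for i
      by (simp_all add: B_def H_def)
    have UB: "(\<Union>i\<in>C. B i) \<in> sets lebesgue"
      using BH C(1) by (intro sets.countable_UN') auto
    have "emeasure lebesgue S \<le> emeasure lebesgue ((S - (\<Union>i\<in>C. B i)) \<union> (\<Union>i\<in>C. B i))"
      using S UB by (intro emeasure_mono) auto
    also have "\<dots> = emeasure lebesgue (\<Union>i\<in>C. B i)"
      using C(4) UB by (subst Un_commute, intro emeasure_Un_null_set)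
        (simp_all add: negligible_iff_null_sets)
    finally have "\<theta> * emeasure lebesgue S \<le> \<theta> * emeasure lebesgue (\<Union>i\<in>C. B i)"
      by (intro mult_left_mono) auto
    also have "\<dots> = (\<integral>\<^sup>+i. \<theta> * emeasure lebesgue (B i) \<partial>count_space C)"
      using B BH C(1) by (subst emeasure_UN_countable) (auto simp: nn_integral_cmult)
    also have "\<dots> = (\<integral>\<^sup>+i. emeasure lebesgue (H i) \<partial>count_space C)"
    proof (rule nn_integral_cong)
      fix i assume "i \<in> space (count_space C)"
      then have "snd i > 0" using C(2) by (auto simp: I_def)
      then show "\<theta> * emeasure lebesgue (B i) = emeasure lebesgue (H i)"
        using \<open>k > 0\<close> unfolding B_def H_def \<theta>_def
        by (subst (1 2) emeasure_lebesgue_ball)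
          (auto simp: ennreal_mult[symmetric] power_mult_distrib mult_ac)
    qed
    also have "\<dots> = emeasure lebesgue (\<Union>i\<in>C. H i)"
      using H BH C(1) by (subst emeasure_UN_countable) auto
    also have "\<dots> \<le> emeasure lebesgue (T - S)"
    proof (rule emeasure_mono)
      have "H i \<subseteq> T - S" if "i \<in> C" for i
        using HB[OF that] C(2) that by (auto simp: I_def B_def)
      then show "(\<Union>i\<in>C. H i) \<subseteq> T - S" by blast
    qed (simp add: T(3) fmeasurableD)
    also have "\<dots> < ennreal e" by fact
    finally show ?thesis .
  qed
  then have "\<theta> * emeasure lebesgue S = 0"
    by (rule ennreal_eq_0_if_less)
  then show ?thesis using \<theta> S by auto
qed

text \<open>By the Vitali covering lemma, fivefold enlargements of disjoint balls in a small open
  neighbourhood cover \<open>S\<close>. A ball's diameter to the power \<open>DIM('a)\<close> is a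
  constant multiple of its volume, so the covering sum is controlled by the measure of the
  neighbourhood.\<close>

lemma hausdorff_outer_measure_null_sets:
  fixes S :: "'a::euclidean_space set"
  assumes "S \<in> null_sets lebesgue"
  shows "hausdorff_outer_measure DIM('a) S = 0"
proof -
  have "hausdorff_premeasure DIM('a) \<delta> S = 0" if "\<delta> > 0" for \<delta>
  proof (rule ennreal_eq_0_if_less)
    fix e :: real assume "e > 0"
    define v where "v = unit_ball_vol DIM('a)"
    have "v > 0" by (simp add: v_def)
    \<comment> \<open>The factor \<open>10 ^ DIM('a) / v\<close>, which converts volumes of the
      disjoint balls into powers of diameters of the enlarged ones, turns \<open>e'\<close> into
      \<open>e / 2\<close>.\<close>
    define e' where "e' = e * v / (2 * 10 ^ DIM('a))"
    have "e' > 0" using \<open>e > 0\<close> \<open>v > 0\<close> by (simp add: e'_def)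
    obtain T where T: "open T" "S \<subseteq> T" "T - S \<in> lmeasurable" "emeasure lebesgue (T - S) < ennreal e'"
      using sets_lebesgue_outer_open[OF null_setsD2[OF assms] \<open>e' > 0\<close>] .
    have "\<exists>r. 0 < r \<and> r \<le> \<delta> / 10 \<and> ball x r \<subseteq> T" if "x \<in> S" for x
    proof -
      obtain d' where d': "d' > 0" "ball x d' \<subseteq> T" using T \<open>x \<in> S\<close> by (meson openE subsetD)
      then show ?thesis using \<open>\<delta> > 0\<close>
        by (intro exI[of _ "min d' (\<delta>/10)"]) (auto simp: subset_ball)
    qed
    then obtain r where r: "\<And>x. x \<in> S \<Longrightarrow> 0 < r x \<and> r x \<le> \<delta> / 10 \<and> ball x (r x) \<subseteq> T"
      by metis
    obtain C where C: "countable C" "C \<subseteq> S" "pairwise (\<lambda>i j. disjnt (ball i (r i)) (ball j (r j))) C"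
        "S \<subseteq> (\<Union>i\<in>C. ball i (5 * r i))"
      using Vitali_covering_lemma_balls[of S "\<lambda>i. i" r S "\<delta>/10"] r by force
    have disj: "disjoint_family_on (\<lambda>i. ball i (r i)) C"
      using C(3) by (auto simp: disjoint_family_on_def pairwise_def disjnt_def)
    \<comment> \<open>A cover is a sequence over all naturals; indices that code no ball receive the
      empty set, which \<open>diam_powr\<close> counts as 0.\<close>
    define U where "U = (\<lambda>n. if n \<in> to_nat_on C ` C then
         ball (from_nat_into C n) (5 * r (from_nat_into C n)) else {})"
    have U: "U (to_nat_on C i) = ball i (5 * r i)" if "i \<in> C" for i
      using that C(1) by (auto simp: U_def)
    have dia: "diameter (ball i (5 * r i)) = 10 * r i" if "i \<in> C" for i
      using r[of i] C(2) that by (auto simp: diameter_ball)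
    have cov: "U \<in> delta_covers \<delta> S"
      unfolding delta_covers_def
    proof (intro CollectI conjI allI)
      show "S \<subseteq> (\<Union>i. U i)"
      proof
        fix x assume "x \<in> S"
        then obtain i where "i \<in> C" "x \<in> ball i (5 * r i)" using C(4) by blast
        then show "x \<in> (\<Union>i. U i)" using U[OF \<open>i \<in> C\<close>] by blast
      qed
      fix n
      show "bounded (U n)" by (simp add: U_def)
      show "diameter (U n) \<le> \<delta>"
      proof (cases "n \<in> to_nat_on C ` C")
        case True
        then obtain i where i: "i \<in> C" "n = to_nat_on C i" by blast
        then show ?thesis using U[OF i(1)] dia[OF i(1)] r[of i] C(2) by auto
      qed (use \<open>\<delta> > 0\<close> in \<open>simp add: U_def\<close>)
    qed
    have "hausdorff_premeasure DIM('a) \<delta> S \<le> (\<Sum>n. diam_powr DIM('a) (U n))"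
      unfolding hausdorff_premeasure_def by (rule INF_lower[OF cov])
    also have "\<dots> = (\<integral>\<^sup>+n. diam_powr DIM('a) (U n) \<partial>count_space UNIV)"
      by (simp add: nn_integral_count_space_nat)
    also have "\<dots> = (\<integral>\<^sup>+n. diam_powr DIM('a) (U n) \<partial>count_space (to_nat_on C ` C))"
      by (rule nn_integral_count_space_eq) (auto simp: U_def diam_powr_def)
    also have "\<dots> = (\<integral>\<^sup>+i. diam_powr DIM('a) (U (to_nat_on C i)) \<partial>count_space C)"
      by (subst nn_integral_bij_count_space[symmetric, of "to_nat_on C" C])
        (auto simp: bij_betw_def inj_on_to_nat_on C(1))
    also have "\<dots> = (\<integral>\<^sup>+i. ennreal (10 ^ DIM('a) / v) * emeasure lebesgue (ball i (r i)) \<partial>count_space C)"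
    proof (rule nn_integral_cong)
      fix i assume "i \<in> space (count_space C)"
      then have i: "i \<in> C" by simp
      then have "r i > 0" using C(2) r by auto
      then show "diam_powr DIM('a) (U (to_nat_on C i)) =
          ennreal (10 ^ DIM('a) / v) * emeasure lebesgue (ball i (r i))"
        using U[OF i] dia[OF i] \<open>v > 0\<close>
        by (subst emeasure_lebesgue_ball)
          (auto simp: diam_powr_def v_def[symmetric] powr_realpow power_mult_distrib ennreal_mult'[symmetric] simp del: emeasure_completion)
    qed
    also have "\<dots> = ennreal (10 ^ DIM('a) / v) * emeasure lebesgue (\<Union>i\<in>C. ball i (r i))"
      using disj C(1) by (subst emeasure_UN_countable) (auto simp: nn_integral_cmult)
    also have "\<dots> \<le> ennreal (10 ^ DIM('a) / v) * emeasure lebesgue ((T - S) \<union> S)"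
      using r C T assms by (intro mult_left_mono emeasure_mono sets.Un) (auto simp: fmeasurableD subset_eq)
    also have "\<dots> = ennreal (10 ^ DIM('a) / v) * emeasure lebesgue (T - S)"
      using assms T by (subst emeasure_Un_null_set) (auto simp: fmeasurableD)
    also have "\<dots> \<le> ennreal (10 ^ DIM('a) / v) * ennreal e'"
      using T(4) by (intro mult_left_mono) auto
    also have "\<dots> = ennreal (e / 2)"
      using \<open>v > 0\<close> \<open>e' > 0\<close> by (subst ennreal_mult[symmetric]) (auto simp: e'_def field_simps)
    also have "\<dots> < ennreal e" using \<open>e > 0\<close> by (auto simp: ennreal_less_iff)
    finally show "hausdorff_premeasure DIM('a) \<delta> S < ennreal e" .
  qed
  then show ?thesis by (simp add: hausdorff_outer_measure_def)
qed

section \<open>Positive Hausdorff measure of Cantor sets\<close>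

text \<open>The inequality is strict only at \<open>s = 0\<close> for nonempty sets of diameter 0,
  because \<open>0 powr 0 = 0\<close>.\<close>

lemma diam_powr_ge:
  "ennreal (diameter U powr s) \<le> diam_powr s U"
  by (auto simp: diam_powr_def diameter_def)

text \<open>Level \<open>n\<close> is the last one with \<open>d \<le> r ^ n\<close>. Then
  \<open>r ^ Suc n < d\<close>, and \<open>real K * r powr s \<ge> 1\<close> bounds the weight
  \<open>(1 / real K) ^ Suc n\<close> by \<open>d powr s\<close>. For \<open>d = 0\<close> there is
  no last level, and \<eta> absorbs the weight of a deep one.\<close>

lemma exists_scale_of_diameter:
  fixes d r :: real and K :: nat
  assumes r: "0 < r" "r < 1" and K: "K \<ge> 2" "real K * r powr s \<ge> 1" and s: "s \<ge> 0"
    and d: "0 \<le> d" "d \<le> 1" and "\<eta> > 0"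
  obtains n where "d \<le> r ^ n" "(1 / real K) ^ n \<le> real K * d powr s + \<eta>"
proof (cases "d = 0")
  case True
  obtain n where "(1 / real K) ^ n < \<eta>"
    using real_arch_pow_inv[OF \<open>\<eta> > 0\<close>, of "1 / real K"] K by auto
  then show ?thesis using True r by (intro that[of n]) auto
next
  case False
  then have "d > 0" using d by simp
  obtain m where m: "r ^ m < d" using real_arch_pow_inv[OF \<open>d > 0\<close> r(2)] by blast
  define n where "n = (LEAST m. r ^ Suc m < d)"
  have ex: "r ^ Suc m < d"
    using r by (intro order.strict_trans1[OF power_decreasing m]) auto
  have 1: "r ^ Suc n < d"
    unfolding n_def by (rule LeastI[of _ m]) fact
  have 2: "d \<le> r ^ n"
  proof (cases n)
    case (Suc l)
    then have "\<not> r ^ Suc l < d" using not_less_Least[of l "\<lambda>m. r ^ Suc m < d"] by (simp add: n_def)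
    then show ?thesis using Suc by simp
  qed (use d in simp)
  have "1 / real K \<le> r powr s" using K by (simp add: field_simps)
  then have "(1 / real K) ^ Suc n \<le> (r powr s) ^ Suc n" by (intro power_mono) auto
  also have "\<dots> = (r ^ Suc n) powr s"
    using r by (simp add: powr_powr powr_realpow[symmetric] mult.commute del: power_Suc)
  also have "\<dots> \<le> d powr s" using 1 r s by (intro powr_mono2) auto
  finally have "(1 / real K) ^ n \<le> real K * d powr s" using K by (simp add: field_simps)
  then show ?thesis using 2 \<open>\<eta> > 0\<close> by (intro that[of n]) auto
qed

text \<open>
  The uniform distribution on the branches of a \<open>K\<close>-ary tree is Lebesgue measure on the unit
  interval, with branches coded by base-\<open>K\<close> expansions; this gives the mass distribution
  principle without constructing a measure on the set itself.
\<close>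
lemma hausdorff_outer_measure_tree_neq_0:
  fixes A :: "'a::metric_space set" and Q :: "nat \<Rightarrow> nat \<Rightarrow> 'a set"
  assumes r: "0 < r" "r < 1" and K: "K \<ge> 2" "real K * r powr s \<ge> 1" and s: "s \<ge> 0"
    and branch: "\<And>t::real. 0 \<le> t \<Longrightarrow> t < 1 \<Longrightarrow> \<exists>x\<in>A. \<forall>n. x \<in> Q n (nat \<lfloor>real K ^ n * t\<rfloor>)"
    and meets: "\<And>U n. bounded U \<Longrightarrow> diameter U \<le> r ^ n \<Longrightarrow> card {j. j < K ^ n \<and> Q n j \<inter> U \<noteq> {}} \<le> N"
  shows "hausdorff_outer_measure s A \<noteq> 0"
proof
  assume "hausdorff_outer_measure s A = 0"
  then have "hausdorff_premeasure s 1 A = 0"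
    unfolding hausdorff_outer_measure_def
    by (metis SUP_upper greaterThan_iff le_zero_eq zero_less_one)
  \<comment> \<open>Together with the \<open>\<eta> i\<close> below, this makes the total length of
    the intervals at most 1/4 + 1/4, although they cover the unit interval.\<close>
  define \<epsilon> where "\<epsilon> = 1 / (4 * (real N + 1) * real K)"
  have "\<epsilon> > 0" using K by (simp add: \<epsilon>_def)
  have "hausdorff_premeasure s 1 A < ennreal \<epsilon>"
    using \<open>\<epsilon> > 0\<close> \<open>hausdorff_premeasure s 1 A = 0\<close> by simp
  then obtain U where U: "U \<in> delta_covers 1 A" "(\<Sum>i. diam_powr s (U i)) < ennreal \<epsilon>"
    unfolding hausdorff_premeasure_def by (auto simp: INF_less_iff)
  define d where "d = (\<lambda>i. diameter (U i))"
  have Ub: "bounded (U i)" "d i \<le> 1" "0 \<le> d i" and cov: "A \<subseteq> (\<Union>i. U i)" for i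
    using U(1) by (auto simp: delta_covers_def d_def diameter_ge_0)
  define \<eta> where "\<eta> = (\<lambda>i::nat. (1/2) ^ Suc i / (4 * (real N + 1)))"
  have \<eta>: "\<eta> i > 0" for i by (simp add: \<eta>_def)
  have "\<exists>n. d i \<le> r ^ n \<and> (1 / real K) ^ n \<le> real K * d i powr s + \<eta> i" for i
    using exists_scale_of_diameter[OF r K s Ub(3) Ub(2) \<eta>] by metis
  then obtain n where n: "\<And>i. d i \<le> r ^ n i" "\<And>i. (1 / real K) ^ n i \<le> real K * d i powr s + \<eta> i"
    by metis
  define J where "J = (\<lambda>i. {j. j < K ^ n i \<and> Q (n i) j \<inter> U i \<noteq> {}})"
  have J: "finite (J i)" "card (J i) \<le> N" for i
    using meets[OF Ub(1), of i "n i"] n(1)[of i] by (auto simp: J_def d_def)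
  \<comment> \<open>\<open>I n j\<close> is the set of those \<open>t\<close> whose branch passes
    through node \<open>j\<close> of level \<open>n\<close>; its length is the weight of the
    node.\<close>
  define I where "I = (\<lambda>n j. {real j / real K ^ n ..< (real j + 1) / real K ^ n})"
  have I: "emeasure lborel (I m j) = ennreal ((1 / real K) ^ m)" for m j
    using K by (simp add: I_def divide_right_mono diff_divide_distrib[symmetric] power_one_over)
  \<comment> \<open>The branch of \<open>t\<close> leads to a point of \<open>A\<close>, which lies
    in some \<open>U i\<close>; its node on level \<open>n i\<close> therefore belongs to
    \<open>J i\<close>.\<close>
  have "{0..<1} \<subseteq> (\<Union>i. \<Union>j\<in>J i. I (n i) j)"
  proof
    fix t :: real assume t: "t \<in> {0..<1}"
    then obtain x where x: "x \<in> A" "\<And>n. x \<in> Q n (nat \<lfloor>real K ^ n * t\<rfloor>)" using branch[of t] by auto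
    obtain i where i: "x \<in> U i" using x cov by blast
    define j where "j = nat \<lfloor>real K ^ n i * t\<rfloor>"
    have Kp: "real K ^ n i > 0" using K by simp
    have j: "real j \<le> real K ^ n i * t" "real K ^ n i * t < real j + 1"
      using t Kp unfolding j_def by (auto simp: of_nat_nat)
    have "real K ^ n i * t < real K ^ n i" using t Kp by simp
    with j have "real j < real (K ^ n i)" by (simp only: of_nat_power)
    then have "j < K ^ n i" by (simp only: of_nat_less_iff)
    then have "j \<in> J i" using x i by (auto simp: J_def j_def)
    moreover have "t \<in> I (n i) j" using j Kp by (auto simp: I_def field_simps)
    ultimately show "t \<in> (\<Union>i. \<Union>j\<in>J i. I (n i) j)" by blast
  qed
  moreover have meas: "(\<Union>j\<in>J i. I (n i) j) \<in> sets lborel" for i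
    using J(1) by (intro sets.finite_UN) (auto simp: I_def)
  ultimately have "emeasure lborel {0..<1::real} \<le> emeasure lborel (\<Union>i. \<Union>j\<in>J i. I (n i) j)"
    by (intro emeasure_mono) auto
  also have "\<dots> \<le> (\<Sum>i. emeasure lborel (\<Union>j\<in>J i. I (n i) j))"
    using meas by (intro emeasure_subadditive_countably) auto
  also have "\<dots> \<le> (\<Sum>i. ennreal (real N * real K) * diam_powr s (U i) + ennreal (real N * \<eta> i))"
  proof (intro suminf_le summableI)
    fix i
    have "emeasure lborel (\<Union>j\<in>J i. I (n i) j) \<le> (\<Sum>j\<in>J i. emeasure lborel (I (n i) j))"
      using J(1) by (intro emeasure_subadditive_finite) (auto simp: I_def)
    also have "\<dots> = ennreal (real (card (J i)) * (1 / real K) ^ n i)"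
      by (simp add: I ennreal_mult ennreal_of_nat_eq_real_of_nat)
    also have "\<dots> \<le> ennreal (real N * (real K * d i powr s + \<eta> i))"
      using J(2)[of i] n(2)[of i] by (intro ennreal_leI mult_mono) auto
    also have "\<dots> = ennreal (real N * real K) * ennreal (d i powr s) + ennreal (real N * \<eta> i)"
      using \<eta>[of i] by (simp add: ennreal_mult[symmetric] ennreal_plus[symmetric] algebra_simps del: ennreal_plus)
    also have "\<dots> \<le> ennreal (real N * real K) * diam_powr s (U i) + ennreal (real N * \<eta> i)"
      unfolding d_def by (intro add_right_mono mult_left_mono diam_powr_ge) auto
    finally show "emeasure lborel (\<Union>j\<in>J i. I (n i) j)
      \<le> ennreal (real N * real K) * diam_powr s (U i) + ennreal (real N * \<eta> i)" .
  qed
  also have "\<dots> = ennreal (real N * real K) * (\<Sum>i. diam_powr s (U i)) + (\<Sum>i. ennreal (real N * \<eta> i))"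
    by (simp add: suminf_add[symmetric] ennreal_suminf_cmult)
  also have "\<dots> \<le> ennreal (real N / (4 * (real N + 1))) + ennreal (real N / (4 * (real N + 1)))"
  proof (rule add_mono)
    have "(\<Sum>i. ennreal (real N * \<eta> i)) = ennreal (real N / (4 * (real N + 1)))"
    proof (rule suminf_ennreal_eq)
      show "0 \<le> real N * \<eta> i" for i using \<eta>[of i] by simp
      show "(\<lambda>i. real N * \<eta> i) sums (real N / (4 * (real N + 1)))"
        using sums_mult[OF power_half_series, of "real N / (4 * (real N + 1))"]
        by (simp add: \<eta>_def mult.commute)
    qed
    then show "(\<Sum>i. ennreal (real N * \<eta> i)) \<le> ennreal (real N / (4 * (real N + 1)))" by simp
    have "ennreal (real N * real K) * (\<Sum>i. diam_powr s (U i)) \<le> ennreal (real N * real K) * ennreal \<epsilon>"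
      using U(2) by (intro mult_left_mono) auto
    also have "\<dots> = ennreal (real N * real K * \<epsilon>)"
      using \<open>\<epsilon> > 0\<close> by (simp add: ennreal_mult)
    also have "real N * real K * \<epsilon> = real N / (4 * (real N + 1))"
      using K by (simp add: \<epsilon>_def)
    finally show "ennreal (real N * real K) * (\<Sum>i. diam_powr s (U i)) \<le> ennreal (real N / (4 * (real N + 1)))" .
  qed
  also have "\<dots> = ennreal (real N / (4 * (real N + 1)) + real N / (4 * (real N + 1)))"
    by (rule ennreal_plus[symmetric]) auto
  also have "\<dots> < ennreal 1"
  proof (rule ennreal_lessI)
    have "real N / (4 * (real N + 1)) \<le> 1 / 4" by (simp add: field_simps)
    then show "real N / (4 * (real N + 1)) + real N / (4 * (real N + 1)) < 1" by linarith
  qed simp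
  finally show False by simp
qed

section \<open>Grid cubes, their subdivision and the Cantor sets that it produces\<close>

definition lattice :: "'a::euclidean_space set" where
  "lattice = {z. \<forall>b\<in>Basis. z \<bullet> b \<in> \<int>}"

text \<open>The cube of side \<open>1 / M ^ n\<close> with lowest corner \<open>z / M ^ n\<close>,
  written without division. It is closed, so that nested cubes have a common point; neighbours share
  faces.\<close>

definition grid_cube :: "nat \<Rightarrow> nat \<Rightarrow> 'a::euclidean_space \<Rightarrow> 'a set" where
  "grid_cube M n z = {x. \<forall>b\<in>Basis. z \<bullet> b \<le> real M ^ n * (x \<bullet> b) \<and> real M ^ n * (x \<bullet> b) \<le> z \<bullet> b + 1}"

text \<open>Offsets of children: the cube \<open>z\<close> of level \<open>n\<close> splits into the
  cubes \<open>real M *\<^sub>R z + w\<close> of level \<open>Suc n\<close>.\<close>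

definition digits :: "nat \<Rightarrow> 'a::euclidean_space set" where
  "digits M = {w \<in> lattice. \<forall>b\<in>Basis. 0 \<le> w \<bullet> b \<and> w \<bullet> b < real M}"

lemma card_lattice_box_le:
  fixes I :: "'a::euclidean_space \<Rightarrow> int set"
  assumes "\<And>b. b \<in> Basis \<Longrightarrow> finite (I b) \<and> card (I b) \<le> m"
  shows "finite {z\<in>lattice. \<forall>b\<in>Basis. z \<bullet> b \<in> real_of_int ` I b}"
    "card {z\<in>lattice. \<forall>b\<in>Basis. z \<bullet> b \<in> real_of_int ` I b} \<le> m ^ DIM('a)"
proof -
  let ?Z = "{z\<in>lattice. \<forall>b\<in>Basis. z \<bullet> b \<in> real_of_int ` I b}"
  let ?P = "Pi\<^sub>E (Basis :: 'a set) I"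
  define f where "f = (\<lambda>g. \<Sum>b\<in>Basis. real_of_int (g b) *\<^sub>R (b::'a))"
  have sub: "?Z \<subseteq> f ` ?P"
  proof
    fix z assume z: "z \<in> ?Z"
    then have "\<forall>b\<in>Basis. \<exists>i\<in>I b. z \<bullet> b = real_of_int i" by auto
    then obtain g where g: "\<forall>b\<in>Basis. g b \<in> I b \<and> z \<bullet> b = real_of_int (g b)" by metis
    have "z = (\<Sum>b\<in>Basis. (z \<bullet> b) *\<^sub>R b)" by (simp add: euclidean_representation)
    also have "\<dots> = f (restrict g Basis)" using g by (simp add: f_def)
    finally show "z \<in> f ` ?P" using g by (intro image_eqI[of _ _ "restrict g Basis"]) auto
  qed
  have fin: "finite ?P" using assms by (intro finite_PiE) auto
  then show "finite ?Z" using sub finite_subset by blast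
  have "card ?Z \<le> card ?P" using fin sub by (meson card_image_le card_mono finite_imageI order_trans)
  also have "\<dots> = (\<Prod>b\<in>Basis. card (I b))" by (simp add: card_PiE)
  also have "\<dots> \<le> (\<Prod>b\<in>(Basis::'a set). m)" using assms by (intro prod_mono) auto
  finally show "card ?Z \<le> m ^ DIM('a)" by simp
qed

lemma grid_cubes_meeting_small_set:
  fixes U :: "'a::euclidean_space set"
  assumes "M > 0" and U: "\<And>u v. u \<in> U \<Longrightarrow> v \<in> U \<Longrightarrow> real M ^ n * dist u v \<le> 1"
  shows "finite {z\<in>lattice. grid_cube M n z \<inter> U \<noteq> {}}"
    "card {z\<in>lattice. grid_cube M n z \<inter> U \<noteq> {}} \<le> 4 ^ DIM('a)"
proof -
  have "finite {z\<in>lattice. grid_cube M n z \<inter> U \<noteq> {}} \<and>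
    card {z\<in>lattice. grid_cube M n z \<inter> U \<noteq> {}} \<le> 4 ^ DIM('a)"
  proof (cases "U = {}")
    case False
    then obtain u where u: "u \<in> U" by blast
    \<comment> \<open>With \<open>t = real M ^ n * (u \<bullet> b)\<close>, a cube that meets
      \<open>U\<close> has \<open>z \<bullet> b\<close> between \<open>t - 2\<close> and
      \<open>t + 1\<close>: one unit for the distance to \<open>u\<close>, one more below for the
      side of the cube. At most four integers qualify.\<close>
    define I where "I = (\<lambda>b. {\<lceil>real M ^ n * (u \<bullet> b)\<rceil> - 2 .. \<lceil>real M ^ n * (u \<bullet> b)\<rceil> + 1})"
    have I: "finite (I b) \<and> card (I b) \<le> 4" for b by (simp add: I_def)
    have "{z\<in>lattice. grid_cube M n z \<inter> U \<noteq> {}} \<subseteq> {z\<in>lattice. \<forall>b\<in>Basis. z \<bullet> b \<in> real_of_int ` I b}"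
    proof (intro subsetI CollectI conjI ballI)
      fix z :: 'a and b :: 'a assume z: "z \<in> {z\<in>lattice. grid_cube M n z \<inter> U \<noteq> {}}" and b: "b \<in> Basis"
      then obtain v where v: "v \<in> U" "v \<in> grid_cube M n z" by blast
      obtain i where i: "z \<bullet> b = real_of_int i" using z b by (auto simp: lattice_def Ints_def)
      have "\<bar>(v - u) \<bullet> b\<bar> \<le> dist v u" using b by (simp add: dist_norm Basis_le_norm)
      then have "real M ^ n * \<bar>(v - u) \<bullet> b\<bar> \<le> real M ^ n * dist v u" by (intro mult_left_mono) auto
      also have "\<dots> \<le> 1" using U v u by blast
      finally have "\<bar>real M ^ n * (v \<bullet> b) - real M ^ n * (u \<bullet> b)\<bar> \<le> 1"
        by (simp add: inner_diff_left abs_mult flip: right_diff_distrib)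
      moreover have "real_of_int i \<le> real M ^ n * (v \<bullet> b)" "real M ^ n * (v \<bullet> b) \<le> real_of_int i + 1"
        using v b i by (auto simp: grid_cube_def)
      ultimately have "i \<in> I b" unfolding I_def atLeastAtMost_iff by linarith
      then show "z \<bullet> b \<in> real_of_int ` I b" using i by blast
    qed auto
    then show ?thesis
      using card_lattice_box_le[of I 4] I by (meson card_mono finite_subset order_trans)
  qed simp
  then show "finite {z\<in>lattice. grid_cube M n z \<inter> U \<noteq> {}}"
    "card {z\<in>lattice. grid_cube M n z \<inter> U \<noteq> {}} \<le> 4 ^ DIM('a)" by blast+
qed

lemma digits_image:
  "digits M = (\<lambda>g. \<Sum>b\<in>Basis. real (g b) *\<^sub>R (b::'a::euclidean_space)) ` (Basis \<rightarrow>\<^sub>E {..<M})"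
proof (intro equalityI subsetI)
  fix z :: 'a assume z: "z \<in> digits M"
  have "\<exists>i<M. z \<bullet> b = real i" if "b \<in> Basis" for b
  proof -
    have "z \<bullet> b \<in> \<int>" "0 \<le> z \<bullet> b" "z \<bullet> b < real M"
      using z that by (auto simp: digits_def lattice_def)
    then obtain k where "z \<bullet> b = real_of_int k" by (auto simp: Ints_def)
    then show ?thesis using \<open>0 \<le> z \<bullet> b\<close> \<open>z \<bullet> b < real M\<close> by (intro exI[of _ "nat k"]) auto
  qed
  then obtain g where g: "\<forall>b\<in>Basis. g b < M \<and> z \<bullet> b = real (g b)" by metis
  have "z = (\<Sum>b\<in>Basis. (z \<bullet> b) *\<^sub>R b)" by (simp add: euclidean_representation)
  also have "\<dots> = (\<Sum>b\<in>Basis. real (restrict g Basis b) *\<^sub>R b)" using g by simp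
  finally show "z \<in> (\<lambda>g. \<Sum>b\<in>Basis. real (g b) *\<^sub>R b) ` (Basis \<rightarrow>\<^sub>E {..<M})"
    using g by (intro image_eqI[of _ _ "restrict g Basis"]) auto
next
  fix z :: 'a assume "z \<in> (\<lambda>g. \<Sum>b\<in>Basis. real (g b) *\<^sub>R b) ` (Basis \<rightarrow>\<^sub>E {..<M})"
  then obtain g where "g \<in> Basis \<rightarrow>\<^sub>E {..<M}" "z = (\<Sum>b\<in>Basis. real (g b) *\<^sub>R b)" by blast
  then show "z \<in> digits M" by (auto simp: digits_def lattice_def)
qed

lemma finite_digits: "finite (digits M :: 'a::euclidean_space set)"
  unfolding digits_image by (intro finite_imageI finite_PiE) auto

lemma card_digits: "card (digits M :: 'a::euclidean_space set) = M ^ DIM('a)"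
proof -
  have "inj_on (\<lambda>g. \<Sum>b\<in>Basis. real (g b) *\<^sub>R (b::'a)) (Basis \<rightarrow>\<^sub>E {..<M})"
  proof (rule inj_onI)
    fix g h :: "'a \<Rightarrow> nat"
    assume gh: "g \<in> Basis \<rightarrow>\<^sub>E {..<M}" "h \<in> Basis \<rightarrow>\<^sub>E {..<M}"
      and eq: "(\<Sum>b\<in>Basis. real (g b) *\<^sub>R b) = (\<Sum>b\<in>Basis. real (h b) *\<^sub>R b)"
    have "g b = h b" if "b \<in> Basis" for b
    proof -
      have "(\<Sum>b\<in>Basis. real (g b) *\<^sub>R b) \<bullet> b = (\<Sum>b\<in>Basis. real (h b) *\<^sub>R b) \<bullet> b"
        by (simp only: eq)
      then show ?thesis using that by simp
    qed
    then show "g = h" using gh by (intro PiE_ext)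
  qed
  then show ?thesis unfolding digits_image by (simp add: card_image card_PiE)
qed

lemma lattice_coord:
  "z \<in> lattice \<Longrightarrow> b \<in> Basis \<Longrightarrow> \<exists>i. z \<bullet> b = real_of_int i"
  by (auto simp: lattice_def Ints_def)

lemma digits_coord:
  "w \<in> digits M \<Longrightarrow> b \<in> Basis \<Longrightarrow> \<exists>i. w \<bullet> b = real_of_int i \<and> 0 \<le> i \<and> i < int M"
  using lattice_coord[of w b] by (force simp: digits_def)

text \<open>Uniqueness of division with remainder by \<open>M\<close> in each coordinate. Cubes with
  different parents or different digits thus have different indices.\<close>

lemma lattice_digits_cancel:
  fixes z z' :: "'a::euclidean_space"
  assumes "z \<in> lattice" "z' \<in> lattice" "w \<in> digits M" "w' \<in> digits M"
    and eq: "real M *\<^sub>R z + w = real M *\<^sub>R z' + w'"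
  shows "z = z' \<and> w = w'"
proof -
  have "z \<bullet> b = z' \<bullet> b" if b: "b \<in> Basis" for b
  proof -
    obtain i j where z: "z \<bullet> b = real_of_int i" "z' \<bullet> b = real_of_int j"
      using assms(1,2) lattice_coord b by metis
    obtain k l where w: "w \<bullet> b = real_of_int k" "w' \<bullet> b = real_of_int l"
      and kl: "0 \<le> k" "k < int M" "0 \<le> l" "l < int M"
      using assms(3,4) digits_coord b by metis
    have "(real M *\<^sub>R z + w) \<bullet> b = (real M *\<^sub>R z' + w') \<bullet> b" by (simp only: eq)
    then have "real_of_int (int M * i + k) = real_of_int (int M * j + l)"
      using z w by (simp add: inner_add_left)
    then have "int M * i + k = int M * j + l" by (simp only: of_int_eq_iff)
    then have "(int M * i + k) div int M = (int M * j + l) div int M" by simp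
    then have "i = j" using kl by simp
    then show ?thesis using z by simp
  qed
  then have "z = z'" by (rule euclidean_eqI)
  then show ?thesis using eq by simp
qed

lemma lattice_child: "z \<in> lattice \<Longrightarrow> w \<in> digits M \<Longrightarrow> real M *\<^sub>R z + w \<in> lattice"
  by (auto simp: lattice_def digits_def inner_add_left)

lemma grid_cube_child:
  assumes "M > 0" "w \<in> digits M"
  shows "grid_cube M (Suc n) (real M *\<^sub>R z + w) \<subseteq> grid_cube M n z"
proof (clarsimp simp only: grid_cube_def, intro conjI)
  fix x b :: 'a
  assume "\<forall>b\<in>Basis. (real M *\<^sub>R z + w) \<bullet> b \<le> real M ^ Suc n * (x \<bullet> b) \<and>
      real M ^ Suc n * (x \<bullet> b) \<le> (real M *\<^sub>R z + w) \<bullet> b + 1" and b: "b \<in> Basis"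
  then have x: "real M * (z \<bullet> b) + w \<bullet> b \<le> real M * (real M ^ n * (x \<bullet> b))"
      "real M * (real M ^ n * (x \<bullet> b)) \<le> real M * (z \<bullet> b) + w \<bullet> b + 1"
    by (simp_all add: inner_add_left mult.assoc)
  \<comment> \<open>Integrality sharpens \<open>k < int M\<close> to
    \<open>w \<bullet> b + 1 \<le> real M\<close>, so the child stays below the upper faces of its
    parent.\<close>
  obtain k where "w \<bullet> b = real_of_int k" "0 \<le> k" "k < int M" using digits_coord[OF assms(2) b] by blast
  then have w: "0 \<le> w \<bullet> b" "w \<bullet> b + 1 \<le> real M" by linarith+
  have "real M * (z \<bullet> b) \<le> real M * (real M ^ n * (x \<bullet> b))" using x w by linarith
  then show "z \<bullet> b \<le> real M ^ n * (x \<bullet> b)" using \<open>M > 0\<close> by simp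
  have "real M * (real M ^ n * (x \<bullet> b)) \<le> real M * (z \<bullet> b + 1)" using x w by (simp add: distrib_left)
  then show "real M ^ n * (x \<bullet> b) \<le> z \<bullet> b + 1" using \<open>M > 0\<close> by (simp only: mult_le_cancel_left_pos of_nat_0_less_iff)
qed

lemma grid_cube_eq_cbox:
  assumes "M > 0"
  shows "grid_cube M n z = cbox (z /\<^sub>R real M ^ n) ((z + One) /\<^sub>R real M ^ n)"
  using assms by (auto simp: grid_cube_def mem_box inner_add_left field_simps)

lemma corner_in_grid_cube: "M > 0 \<Longrightarrow> z /\<^sub>R real M ^ n \<in> grid_cube M n z"
  by (simp add: grid_cube_def flip: mult.assoc)

text \<open>A node \<open>j < K ^ n\<close> is read as a word of \<open>n\<close>
  base-\<open>K\<close> digits: \<open>j div K\<close> is its parent, \<open>j mod K\<close> its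
  number among the siblings, and \<open>e\<close> lists the chosen children of a cube.\<close>

primrec tree_code :: "nat \<Rightarrow> nat \<Rightarrow> (nat \<Rightarrow> 'a \<Rightarrow> nat \<Rightarrow> 'a) \<Rightarrow> 'a::euclidean_space \<Rightarrow> nat \<Rightarrow> nat \<Rightarrow> 'a" where
  "tree_code M K e z0 0 j = z0"
| "tree_code M K e z0 (Suc n) j =
    real M *\<^sub>R tree_code M K e z0 n (j div K) + e n (tree_code M K e z0 n (j div K)) (j mod K)"

text \<open>Choosing and numbering \<open>K\<close> good children of every good cube gives a
  \<open>K\<close>-ary tree. Compactness puts a point of \<open>A\<close> on each branch, and a set
  of diameter at most \<open>(1 / M) ^ n\<close> meets at most \<open>4 ^ DIM('a)\<close> cubes of
  level \<open>n\<close>, so the mass distribution principle for trees applies.\<close>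

lemma cantor_hausdorff_outer_measure_neq_0:
  fixes A :: "'a::euclidean_space set" and good :: "nat \<Rightarrow> 'a \<Rightarrow> bool"
  assumes M: "M \<ge> 2" and K: "K \<ge> 2" "real K * (1 / real M) powr s \<ge> 1" and s: "s \<ge> 0"
    and root: "z0 \<in> lattice" "good 0 z0"
    and children: "\<And>n z. z \<in> lattice \<Longrightarrow> good n z \<Longrightarrow>
      K \<le> card {w \<in> digits M. good (Suc n) (real M *\<^sub>R z + w)}"
    and limit: "\<And>z x. (\<And>n. good n (z n)) \<Longrightarrow> (\<And>n. x \<in> grid_cube M n (z n)) \<Longrightarrow> x \<in> A"
  shows "hausdorff_outer_measure s A \<noteq> 0"
proof -
  define G where "G = (\<lambda>n z. {w \<in> digits M. good (Suc n) (real M *\<^sub>R z + w)})"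
  have ex: "\<exists>f. inj_on f {..<K} \<and> f ` {..<K} \<subseteq> G n z" if "z \<in> lattice" "good n z" for n z
  proof -
    have "finite (G n z)" by (rule finite_subset[OF _ finite_digits[of M]]) (auto simp: G_def)
    then show ?thesis using children[OF that] card_le_inj[of "{..<K}" "G n z"] by (auto simp: G_def)
  qed
  define e where "e = (\<lambda>n z. SOME f. inj_on f {..<K} \<and> f ` {..<K} \<subseteq> G n z)"
  have e: "inj_on (e n z) {..<K} \<and> e n z ` {..<K} \<subseteq> G n z" if "z \<in> lattice" "good n z" for n z
    using someI_ex[OF ex[OF that]] unfolding e_def .
  define Z where "Z = tree_code M K e z0"
  have Z0: "Z 0 j = z0" and ZS: "Z (Suc n) j = real M *\<^sub>R Z n (j div K) + e n (Z n (j div K)) (j mod K)" for n j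
    by (simp_all add: Z_def)
  have ZG: "Z n j \<in> lattice \<and> good n (Z n j)" for n j
  proof (induction n arbitrary: j)
    case (Suc n)
    have "j mod K < K" using K by simp
    then have "e n (Z n (j div K)) (j mod K) \<in> G n (Z n (j div K))"
      using e[of "Z n (j div K)" n] Suc by blast
    then show ?case using Suc lattice_child by (auto simp: ZS G_def)
  qed (use root Z0 in simp)
  have ed: "e n (Z n j) (i mod K) \<in> digits M" for n j i
  proof -
    have "i mod K < K" using K by simp
    then show ?thesis using e[of "Z n j" n] ZG[of n j] by (auto simp: G_def)
  qed
  \<comment> \<open>Distinct nodes of a level carry distinct cubes, so nodes near a set can be
    counted by counting cubes.\<close>
  have inj: "inj_on (Z n) {..<K ^ n}" for n
  proof (induction n)
    case (Suc n)
    show ?case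
    proof (rule inj_onI)
      fix i j assume ij: "i \<in> {..<K ^ Suc n}" "j \<in> {..<K ^ Suc n}" "Z (Suc n) i = Z (Suc n) j"
      have eq: "Z n (i div K) = Z n (j div K)"
        "e n (Z n (i div K)) (i mod K) = e n (Z n (j div K)) (j mod K)"
        using lattice_digits_cancel[OF _ _ ed ed] ZG ij(3) unfolding ZS by blast+
      have d: "i div K = j div K"
        using inj_onD[OF Suc eq(1)] ij(1,2) by (auto simp: less_mult_imp_div_less mult.commute)
      have "inj_on (e n (Z n (j div K))) {..<K}" using e ZG by blast
      moreover have "i mod K < K" "j mod K < K" using K by simp_all
      ultimately have "i mod K = j mod K" using eq(2) unfolding d by (auto dest: inj_onD)
      then show "i = j" using d by (metis div_mult_mod_eq)
    qed
  qed (simp add: lessThan_Suc)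
  show ?thesis
  proof (rule hausdorff_outer_measure_tree_neq_0[where r = "1 / real M" and K = K and N = "4 ^ DIM('a)"
        and Q = "\<lambda>n j. grid_cube M n (Z n j)"])
    show "0 < 1 / real M" "1 / real M < 1" using M by auto
    show "K \<ge> 2" "real K * (1 / real M) powr s \<ge> 1" "s \<ge> 0" by fact+
  next
    fix t :: real assume t: "0 \<le> t" "t < 1"
    define j where "j = (\<lambda>n. nat \<lfloor>real K ^ n * t\<rfloor>)"
    \<comment> \<open>Dropping the last base-\<open>K\<close> digit leads to the parent, so the
      nodes \<open>j n\<close> form a branch.\<close>
    have jS: "j (Suc n) div K = j n" for n
    proof -
      have "\<lfloor>real K ^ n * t\<rfloor> = \<lfloor>real K ^ Suc n * t / real_of_int (int K)\<rfloor>" using K by simp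
      also have "\<dots> = \<lfloor>real K ^ Suc n * t\<rfloor> div int K" by (rule floor_divide_real_eq_div) simp
      finally show ?thesis by (simp add: j_def nat_div_distrib t)
    qed
    define F where "F = (\<lambda>n. grid_cube M n (Z n (j n)))"
    have decr: "F (Suc n) \<subseteq> F n" for n
      unfolding F_def ZS jS by (rule grid_cube_child) (use M ed in auto)
    have "compact (F n)" for n
      using M by (simp add: F_def grid_cube_eq_cbox)
    moreover have "F n \<noteq> {}" for n
      using corner_in_grid_cube[of M n "Z n (j n)"] M by (auto simp: F_def)
    moreover have "F n \<subseteq> F m" if "m \<le> n" for m n
      by (rule lift_Suc_antimono_le[of F, OF decr that])
    ultimately have "\<Inter>(range F) \<noteq> {}" by (rule compact_nest)
    then obtain x where x: "\<And>n. x \<in> F n" by blast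
    have "x \<in> A" using x ZG by (intro limit[of "\<lambda>n. Z n (j n)"]) (auto simp: F_def)
    then show "\<exists>x\<in>A. \<forall>n. x \<in> grid_cube M n (Z n (nat \<lfloor>real K ^ n * t\<rfloor>))"
      using x by (auto simp: F_def j_def)
  next
    fix U :: "'a set" and n assume U: "bounded U" "diameter U \<le> (1 / real M) ^ n"
    let ?J = "{j. j < K ^ n \<and> grid_cube M n (Z n j) \<inter> U \<noteq> {}}"
    let ?C = "{z \<in> lattice. grid_cube M n z \<inter> U \<noteq> {}}"
    have dist: "real M ^ n * dist u v \<le> 1" if "u \<in> U" "v \<in> U" for u v
    proof -
      have "dist u v \<le> (1 / real M) ^ n" using diameter_bounded_bound[OF U(1) that] U(2) by simp
      then show ?thesis using M by (simp add: field_simps power_one_over)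
    qed
    have "card ?J = card (Z n ` ?J)"
      using inj[of n] by (intro card_image[symmetric]) (auto intro: inj_on_subset)
    also have "\<dots> \<le> card ?C"
      using grid_cubes_meeting_small_set(1)[OF _ dist] M ZG by (intro card_mono) auto
    also have "\<dots> \<le> 4 ^ DIM('a)"
      using grid_cubes_meeting_small_set(2)[OF _ dist] M by auto
    finally show "card ?J \<le> 4 ^ DIM('a)" .
  qed
qed

section \<open>Approximation by Hurwitz fractions\<close>

definition Lipschitz_quat :: "quat set" where
  "Lipschitz_quat = {q. Re0 q \<in> \<int> \<and> Im1 q \<in> \<int> \<and> Im2 q \<in> \<int> \<and> Im3 q \<in> \<int>}"

definition cnj_quat :: "quat \<Rightarrow> quat" where
  "cnj_quat q = Quat (Re0 q) (- Im1 q) (- Im2 q) (- Im3 q)"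

lemma norm_quat_power2: "(norm q)\<^sup>2 = (Re0 q)\<^sup>2 + (Im1 q)\<^sup>2 + (Im2 q)\<^sup>2 + (Im3 q)\<^sup>2"
  by (simp add: norm_quat_def)

lemma inverse_quat_eq: "inverse q = cnj_quat q /\<^sub>R (norm q)\<^sup>2"
  by (simp add: inverse_quat_def cnj_quat_def)

lemma Lipschitz_quat_subset_Hurwitz: "Lipschitz_quat \<subseteq> Hurwitz"
  by (auto simp: Lipschitz_quat_def Hurwitz_def)

text \<open>Doubling clears the halves, which transfers integrality arguments from integer
  coordinates to all Hurwitz integers.\<close>

lemma double_Hurwitz:
  assumes "q \<in> Hurwitz"
  shows "2 *\<^sub>R q \<in> Lipschitz_quat"
proof -
  have "2 * x \<in> \<int>" if "x - 1 / 2 \<in> \<int>" for x :: real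
  proof -
    have "2 * x = 2 * (x - 1 / 2) + 1" by simp
    then show ?thesis using that by (metis Ints_1 Ints_add Ints_mult Ints_numeral)
  qed
  then show ?thesis
    using assms by (auto simp: Hurwitz_def Lipschitz_quat_def)
qed

lemma Lipschitz_quat_mult: "p \<in> Lipschitz_quat \<Longrightarrow> q \<in> Lipschitz_quat \<Longrightarrow> p * q \<in> Lipschitz_quat"
  by (simp add: Lipschitz_quat_def times_quat_def)

lemma Lipschitz_quat_cnj: "p \<in> Lipschitz_quat \<Longrightarrow> cnj_quat p \<in> Lipschitz_quat"
  by (simp add: Lipschitz_quat_def cnj_quat_def)

lemma Lipschitz_quat_inner: "p \<in> Lipschitz_quat \<Longrightarrow> q \<in> Lipschitz_quat \<Longrightarrow> inner p q \<in> \<int>"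
  by (simp add: Lipschitz_quat_def inner_quat_def)

lemma Lipschitz_quat_norm_power2: "p \<in> Lipschitz_quat \<Longrightarrow> (norm p)\<^sup>2 \<in> \<int>"
  by (metis Lipschitz_quat_inner power2_norm_eq_inner)

lemma Ints_pos_ge_1: "x \<in> \<int> \<Longrightarrow> 0 < x \<Longrightarrow> 1 \<le> (x::real)"
  by (elim Ints_cases) simp

text \<open>The squared distance times the squared norms of both denominators is a positive integer,
  hence at least 1. Since quaternions do not commute, this is shown by expanding the squared
  distance with the inner product rather than by a common denominator.\<close>

lemma Lipschitz_fractions_separated:
  assumes L: "p \<in> Lipschitz_quat" "q \<in> Lipschitz_quat" "p' \<in> Lipschitz_quat" "q' \<in> Lipschitz_quat"
    and q: "q \<noteq> 0" "q' \<noteq> 0" and ne: "p * inverse q \<noteq> p' * inverse q'"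
  shows "1 / (norm q * norm q') \<le> dist (p * inverse q) (p' * inverse q')"
proof -
  define x where "x = p * inverse q - p' * inverse q'"
  have n: "norm q > 0" "norm q' > 0" "norm x > 0" using q ne by (auto simp: x_def)
  have "(norm x)\<^sup>2 = (norm (p * inverse q))\<^sup>2 + (norm (p' * inverse q'))\<^sup>2
      - 2 * inner (p * inverse q) (p' * inverse q')"
    unfolding x_def power2_norm_eq_inner by (simp add: inner_diff_left inner_diff_right inner_commute)
  also have "inner (p * inverse q) (p' * inverse q') =
      inner (p * cnj_quat q) (p' * cnj_quat q') / ((norm q)\<^sup>2 * (norm q')\<^sup>2)"
    by (simp add: inverse_quat_eq divide_inverse)
  finally have "(norm x)\<^sup>2 = (norm p)\<^sup>2 / (norm q)\<^sup>2 + (norm p')\<^sup>2 / (norm q')\<^sup>2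
      - 2 * (inner (p * cnj_quat q) (p' * cnj_quat q') / ((norm q)\<^sup>2 * (norm q')\<^sup>2))"
    by (simp add: norm_mult norm_inverse power_mult_distrib divide_inverse power_inverse)
  then have eq: "(norm x)\<^sup>2 * ((norm q)\<^sup>2 * (norm q')\<^sup>2) = (norm p)\<^sup>2 * (norm q')\<^sup>2 + (norm p')\<^sup>2 * (norm q)\<^sup>2
      - 2 * inner (p * cnj_quat q) (p' * cnj_quat q')"
    using n by (simp add: field_simps)
  have "(norm x)\<^sup>2 * ((norm q)\<^sup>2 * (norm q')\<^sup>2) \<in> \<int>"
    unfolding eq using L
    by (intro Ints_diff Ints_add Ints_mult Lipschitz_quat_norm_power2 Lipschitz_quat_inner
        Lipschitz_quat_mult Lipschitz_quat_cnj Ints_numeral)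
  then have "1 \<le> (norm x)\<^sup>2 * ((norm q)\<^sup>2 * (norm q')\<^sup>2)"
    using n by (intro Ints_pos_ge_1) auto
  then have "1\<^sup>2 \<le> (norm x * (norm q * norm q'))\<^sup>2" by (simp add: power_mult_distrib)
  then have "1 \<le> norm x * (norm q * norm q')"
    by (rule power2_le_imp_le) simp
  then show ?thesis using n by (simp add: x_def dist_norm field_simps)
qed

text \<open>Doubling numerator and denominator preserves a fraction; the two doubled denominators
  cause the factor 4.\<close>

lemma Hurwitz_fractions_separated:
  assumes H: "p \<in> Hurwitz" "q \<in> Hurwitz" "p' \<in> Hurwitz" "q' \<in> Hurwitz"
    and q: "q \<noteq> 0" "q' \<noteq> 0" and ne: "p * inverse q \<noteq> p' * inverse q'"
  shows "1 / (4 * norm q * norm q') \<le> dist (p * inverse q) (p' * inverse q')"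
proof -
  have *: "(2 *\<^sub>R p) * inverse (2 *\<^sub>R q) = p * inverse q" for p q :: quat
    by (simp add: inverse_scaleR_distrib)
  show ?thesis
    using Lipschitz_fractions_separated[OF H[THEN double_Hurwitz]] q ne unfolding *
    by (simp add: mult_ac)
qed

lemma Hurwitz_norm_power2_ge: "q \<in> Hurwitz \<Longrightarrow> q \<noteq> 0 \<Longrightarrow> 1 / 4 \<le> (norm q)\<^sup>2"
  using Ints_pos_ge_1[OF Lipschitz_quat_norm_power2[OF double_Hurwitz], of q]
  by (simp add: power_mult_distrib)

section \<open>Dirichlet's theorem for quaternions\<close>

lemma norm_quat_le_coords:
  assumes "\<bar>Re0 x\<bar> \<le> e" "\<bar>Im1 x\<bar> \<le> e" "\<bar>Im2 x\<bar> \<le> e" "\<bar>Im3 x\<bar> \<le> e"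
  shows "norm x \<le> 2 * e"
proof (rule power2_le_imp_le)
  have "y\<^sup>2 \<le> e\<^sup>2" if "\<bar>y\<bar> \<le> e" for y using that by (metis abs_le_square_iff abs_ge_zero abs_of_nonneg order_trans)
  from this[OF assms(1)] this[OF assms(2)] this[OF assms(3)] this[OF assms(4)]
  show "(norm x)\<^sup>2 \<le> (2 * e)\<^sup>2" by (simp add: norm_quat_power2 power_mult_distrib)
qed (use assms in linarith)

lemma floor_frac_close:
  fixes x y :: real
  assumes "N > 0" "\<lfloor>real N * frac x\<rfloor> = \<lfloor>real N * frac y\<rfloor>"
  shows "\<bar>(x - y) - real_of_int (\<lfloor>x\<rfloor> - \<lfloor>y\<rfloor>)\<bar> \<le> 1 / real N"
proof -
  have "\<bar>real N * frac x - real N * frac y\<bar> \<le> 1" using assms(2) by linarith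
  then have "real N * \<bar>frac x - frac y\<bar> \<le> 1" by (simp add: abs_mult flip: right_diff_distrib)
  then show ?thesis using \<open>N > 0\<close> by (simp add: frac_def field_simps)
qed

text \<open>Pigeonhole: \<open>(N + 1) ^ 4\<close> multipliers \<open>Q v\<close> compete for
  \<open>N ^ 4\<close> boxes containing the fractional parts of the coordinates of
  \<open>\<xi> * Q v\<close>. The difference of two multipliers that share a box serves as
  \<open>q\<close>, the difference of the integer parts as \<open>p\<close>.\<close>

lemma quat_dirichlet:
  fixes \<xi> :: quat
  assumes "N > 0"
  obtains p q where "p \<in> Lipschitz_quat" "q \<in> Lipschitz_quat" "q \<noteq> 0"
    "norm q \<le> 2 * real N" "norm (\<xi> * q - p) \<le> 2 / real N"
proof -
  define Q where "Q = (\<lambda>(a, b, c, d). Quat (real a) (real b) (real c) (real d))"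
  define D where "D = ({..N} \<times> {..N} \<times> {..N} \<times> {..N})"
  define bx where "bx = (\<lambda>x. nat \<lfloor>real N * frac x\<rfloor>)"
  define f where "f = (\<lambda>v. let x = \<xi> * Q v in (bx (Re0 x), bx (Im1 x), bx (Im2 x), bx (Im3 x)))"
  have bx: "bx x < N" for x
  proof -
    have "real N * frac x < real N" using frac_lt_1[of x] \<open>N > 0\<close> by simp
    then show ?thesis using \<open>N > 0\<close> by (simp add: bx_def floor_less_iff nat_less_iff)
  qed
  have "f ` D \<subseteq> {..<N} \<times> {..<N} \<times> {..<N} \<times> {..<N}"
    using bx by (auto simp: f_def Let_def)
  then have "card (f ` D) \<le> N * (N * (N * N))"
    using card_mono[of "{..<N} \<times> {..<N} \<times> {..<N} \<times> {..<N}" "f ` D"] by (simp add: card_cartesian_product)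
  also have "\<dots> < Suc N * (Suc N * (Suc N * Suc N))"
    by (intro mult_strict_mono) auto
  also have "\<dots> = card D" by (simp add: D_def card_cartesian_product)
  finally have "\<not> inj_on f D" using card_image by fastforce
  then obtain u v where uv: "u \<in> D" "v \<in> D" "u \<noteq> v" "f u = f v" unfolding inj_on_def by blast
  define x y where "x = \<xi> * Q u" and "y = \<xi> * Q v"
  define p where "p = Quat (real_of_int (\<lfloor>Re0 x\<rfloor> - \<lfloor>Re0 y\<rfloor>)) (real_of_int (\<lfloor>Im1 x\<rfloor> - \<lfloor>Im1 y\<rfloor>))
     (real_of_int (\<lfloor>Im2 x\<rfloor> - \<lfloor>Im2 y\<rfloor>)) (real_of_int (\<lfloor>Im3 x\<rfloor> - \<lfloor>Im3 y\<rfloor>))"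
  have bxD: "\<lfloor>real N * frac a\<rfloor> = \<lfloor>real N * frac b\<rfloor>" if "bx a = bx b" for a b
    using that by (simp add: bx_def eq_nat_nat_iff)
  show ?thesis
  proof
    show "p \<in> Lipschitz_quat" by (simp add: p_def Lipschitz_quat_def)
    show "Q u - Q v \<in> Lipschitz_quat" by (auto simp: Q_def Lipschitz_quat_def split: prod.splits)
    show "Q u - Q v \<noteq> 0" using uv(3) by (auto simp: Q_def quat_eq_iff split: prod.splits)
    show "norm (Q u - Q v) \<le> 2 * real N"
      using uv(1,2) by (intro norm_quat_le_coords) (auto simp: Q_def D_def split: prod.splits)
    have "bx (Re0 x) = bx (Re0 y)" "bx (Im1 x) = bx (Im1 y)" "bx (Im2 x) = bx (Im2 y)" "bx (Im3 x) = bx (Im3 y)"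
      using uv(4) by (simp_all add: f_def Let_def x_def y_def)
    note b = this[THEN bxD, THEN floor_frac_close[OF \<open>N > 0\<close>]]
    have "norm ((x - y) - p) \<le> 2 * (1 / real N)"
      using b by (intro norm_quat_le_coords) (simp_all add: p_def)
    then show "norm (\<xi> * (Q u - Q v) - p) \<le> 2 / real N"
      by (simp add: x_def y_def right_diff_distrib)
  qed
qed

section \<open>The badly approximable quaternions form a null set\<close>

definition badly_approximable_with :: "real \<Rightarrow> quat set" where
  "badly_approximable_with c =
    {\<xi>. \<forall>p\<in>Hurwitz. \<forall>q\<in>Hurwitz. q \<noteq> 0 \<longrightarrow> c / (norm q)\<^sup>2 \<le> norm (\<xi> - p * inverse q)}"

lemma closed_badly_approximable_with: "closed (badly_approximable_with c)"
proof -
  have "badly_approximable_with c =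
      (\<Inter>p\<in>Hurwitz. \<Inter>q\<in>Hurwitz - {0}. {\<xi>. c / (norm q)\<^sup>2 \<le> norm (\<xi> - p * inverse q)})"
    by (auto simp: badly_approximable_with_def)
  also have "closed \<dots>"
    by (intro closed_INT ballI closed_Collect_le continuous_intros)
  finally show ?thesis .
qed

lemma badly_approximable_with_null_sets:
  assumes "c > 0"
  shows "badly_approximable_with c \<in> null_sets lebesgue"
proof (rule porous_null_sets)
  \<comment> \<open>The ratio of \<open>c / 2\<close>, which measures the hole, to
    \<open>2 + c / 2\<close>, which adds the Dirichlet error; both get divided by
    \<open>real N * norm q\<close> below.\<close>
  define k where "k = c / (4 + c)"
  show "k > 0" using \<open>c > 0\<close> by (simp add: k_def)
  show "badly_approximable_with c \<in> sets lebesgue"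
    using closed_badly_approximable_with[of c] by (simp add: borel_closed)
  fix \<xi> :: quat and d :: real assume "d > 0"
  obtain N where N: "(4 + c) / d < real N" using reals_Archimedean2 by blast
  moreover have "0 < (4 + c) / d" using \<open>c > 0\<close> \<open>d > 0\<close> by simp
  ultimately have "real N > 0" by linarith
  then have "N > 0" by simp
  obtain p q where pq: "p \<in> Lipschitz_quat" "q \<in> Lipschitz_quat" "q \<noteq> 0"
    "norm q \<le> 2 * real N" "norm (\<xi> * q - p) \<le> 2 / real N"
    using quat_dirichlet[OF \<open>N > 0\<close>] by metis
  define y where "y = p * inverse q"
  have q1: "1 \<le> norm q"
  proof -
    have "1 \<le> (norm q)\<^sup>2" using pq by (intro Ints_pos_ge_1 Lipschitz_quat_norm_power2) auto
    then show ?thesis using power2_le_imp_le[of 1 "norm q"] by simp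
  qed
  have "\<xi> - y = (\<xi> * q - p) * inverse q"
    using pq(3) by (simp add: y_def left_diff_distrib mult.assoc)
  then have "norm (\<xi> - y) = norm (\<xi> * q - p) / norm q"
    by (simp add: norm_mult norm_inverse divide_inverse)
  also have "\<dots> \<le> (2 / real N) / norm q" using pq(5) by (intro divide_right_mono) auto
  finally have dy: "norm (\<xi> - y) \<le> 2 / (real N * norm q)" by simp
  \<comment> \<open>The Dirichlet error plus the radius of the hole, so the ball around \<xi>
    contains the hole around \<open>y\<close>.\<close>
  define r where "r = (2 + c / 2) / (real N * norm q)"
  have Nq: "0 < real N * norm q" using \<open>real N > 0\<close> pq(3) by simp
  have kr: "k * r = (c / 2) / (real N * norm q)"
  proof -
    have "k * (2 + c / 2) = c / 2" using \<open>c > 0\<close> by (simp add: k_def field_simps)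
    then show ?thesis by (simp only: r_def times_divide_eq_right)
  qed
  show "\<exists>r z. 0 < r \<and> r < d \<and> ball z (k * r) \<subseteq> ball \<xi> r \<and> ball z (k * r) \<inter> badly_approximable_with c = {}"
  proof (intro exI conjI)
    show "0 < r" using \<open>c > 0\<close> Nq by (simp add: r_def)
    have "r \<le> (2 + c / 2) / real N"
      unfolding r_def using \<open>c > 0\<close> \<open>real N > 0\<close> q1 Nq
      by (intro divide_left_mono mult_pos_pos) auto
    also have "\<dots> \<le> (4 + c) / real N" using \<open>c > 0\<close> by (intro divide_right_mono) auto
    also have "\<dots> < d" using N \<open>d > 0\<close> \<open>N > 0\<close> by (simp add: field_simps)
    finally show "r < d" .
    have "k * r + 2 / (real N * norm q) = r"
      unfolding kr by (simp add: r_def add_divide_distrib)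
    then have "dist \<xi> x < r" if "dist y x < k * r" for x
      using dy that dist_triangle[of \<xi> x y] unfolding dist_norm by linarith
    then show "ball y (k * r) \<subseteq> ball \<xi> r" by auto
    \<comment> \<open>Because \<open>norm q \<le> 2 * real N\<close>, the hole fits into the ball
      around \<open>y\<close> that the constant \<open>c\<close> excludes.\<close>
    have "k * r \<le> c / (norm q)\<^sup>2"
    proof -
      have "norm q * norm q \<le> 2 * real N * norm q" using pq(4) by (intro mult_right_mono) auto
      then have "c / (2 * real N * norm q) \<le> c / (norm q * norm q)"
        using \<open>c > 0\<close> q1 \<open>real N > 0\<close> by (intro divide_left_mono mult_pos_pos) auto
      then show ?thesis by (simp add: kr power2_eq_square mult.assoc)
    qed
    then show "ball y (k * r) \<inter> badly_approximable_with c = {}"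
      using pq Lipschitz_quat_subset_Hurwitz
      by (force simp: badly_approximable_with_def y_def dist_norm norm_minus_commute)
  qed
qed

text \<open>A smaller constant weakens the condition, so countably many constants suffice.\<close>

lemma badly_approximable_eq_UN:
  "{\<xi>. badly_approximable \<xi>} = (\<Union>n. badly_approximable_with (1 / real (Suc n)))"
proof (intro equalityI subsetI)
  fix \<xi> assume "\<xi> \<in> {\<xi>. badly_approximable \<xi>}"
  then obtain c where c: "c > 0" "\<xi> \<in> badly_approximable_with c"
    by (auto simp: badly_approximable_def badly_approximable_with_def)
  obtain n where n: "1 / real (Suc n) < c" using c(1) nat_approx_posE by blast
  have "1 / real (Suc n) / (norm q)\<^sup>2 \<le> c / (norm q)\<^sup>2" for q :: quat
    using n by (intro divide_right_mono) auto
  then have "\<xi> \<in> badly_approximable_with (1 / real (Suc n))"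
    using c(2) unfolding badly_approximable_with_def by (blast intro: order_trans)
  then show "\<xi> \<in> (\<Union>n. badly_approximable_with (1 / real (Suc n)))" by blast
next
  fix \<xi> assume "\<xi> \<in> (\<Union>n. badly_approximable_with (1 / real (Suc n)))"
  then obtain n where "\<xi> \<in> badly_approximable_with (1 / real (Suc n))" by blast
  moreover have "1 / real (Suc n) > 0" by simp
  ultimately show "\<xi> \<in> {\<xi>. badly_approximable \<xi>}"
    unfolding badly_approximable_def badly_approximable_with_def by blast
qed

lemma badly_approximable_null_sets: "{\<xi>. badly_approximable \<xi>} \<in> null_sets lebesgue"
  unfolding badly_approximable_eq_UN
  by (intro null_sets_UN badly_approximable_with_null_sets) simp

section \<open>A Cantor set of badly approximable quaternions\<close>

lemma dist_grid_cube_le: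
  fixes x y :: quat
  assumes "M > 0" "x \<in> grid_cube M n z" "y \<in> grid_cube M n z"
  shows "dist x y \<le> 2 / real M ^ n"
proof -
  have "\<bar>(x - y) \<bullet> b\<bar> \<le> 1 / real M ^ n" if "b \<in> Basis" for b
  proof -
    have "\<bar>real M ^ n * (x \<bullet> b) - real M ^ n * (y \<bullet> b)\<bar> \<le> 1"
      using assms(2,3) that unfolding grid_cube_def by (simp only: mem_Collect_eq) (smt (verit))
    then have "real M ^ n * \<bar>(x - y) \<bullet> b\<bar> \<le> 1"
      by (simp add: inner_diff_left abs_mult flip: right_diff_distrib)
    then show ?thesis using \<open>M > 0\<close> by (simp add: field_simps)
  qed
  from this[of "Quat 1 0 0 0"] this[of "Quat 0 1 0 0"] this[of "Quat 0 0 1 0"] this[of "Quat 0 0 0 1"]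
  have "norm (x - y) \<le> 2 * (1 / real M ^ n)"
    by (intro norm_quat_le_coords) (simp_all add: Basis_quat_def inner_quat_def)
  then show ?thesis by (simp add: dist_norm)
qed

text \<open>The bound on \<open>q\<close> carries a factor \<open>M\<close> instead of the exponent
  \<open>n - 1\<close>. Passing from \<open>n\<close> to \<open>Suc n\<close>, the new denominators
  satisfy \<open>16 * (norm q)\<^sup>2 < M ^ n\<close>, which separates their fractions by at least
  \<open>4 / M ^ n\<close>, and \<open>16 * M * (norm q)\<^sup>2 \<ge> M ^ n\<close>, which makes
  the radius to be avoided at most \<open>1 / (2 * M ^ Suc n)\<close>.\<close>

definition avoids_rationals :: "nat \<Rightarrow> nat \<Rightarrow> quat \<Rightarrow> bool" where
  "avoids_rationals M n z \<longleftrightarrow> (\<forall>x\<in>grid_cube M n z. \<forall>p\<in>Hurwitz. \<forall>q\<in>Hurwitz.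
     q \<noteq> 0 \<longrightarrow> 16 * real M * (norm q)\<^sup>2 < real M ^ n \<longrightarrow>
     1 / (32 * (real M)\<^sup>2 * (norm q)\<^sup>2) \<le> norm (x - p * inverse q))"

text \<open>Vacuous: nonzero Hurwitz integers have squared norm at least 1/4, so no denominator is
  small enough for level 0.\<close>

lemma avoids_rationals_0:
  assumes "M > 0"
  shows "avoids_rationals M 0 z"
proof -
  have "\<not> 16 * real M * (norm q)\<^sup>2 < real M ^ 0" if "q \<in> Hurwitz" "q \<noteq> 0" for q
  proof -
    have "1 * 4 \<le> real M * (16 * (norm q)\<^sup>2)"
      using Hurwitz_norm_power2_ge[OF that] assms by (intro mult_mono) auto
    then show ?thesis by (simp add: mult_ac)
  qed
  then show ?thesis by (auto simp: avoids_rationals_def)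
qed

text \<open>Every denominator is taken care of from some level on, with a constant that does not
  depend on the level.\<close>

lemma avoids_rationals_limit:
  assumes "M \<ge> 2" "\<And>n. avoids_rationals M n (z n)" "\<And>n. x \<in> grid_cube M n (z n)"
  shows "badly_approximable x"
  unfolding badly_approximable_def
proof (intro exI conjI ballI impI)
  show "0 < 1 / (32 * (real M)\<^sup>2)" using assms(1) by simp
  fix p q assume pq: "p \<in> Hurwitz" "q \<in> Hurwitz" "q \<noteq> (0::quat)"
  obtain n where n: "16 * real M * (norm q)\<^sup>2 < real M ^ n"
    using real_arch_pow[of "real M"] assms(1) by auto
  then have "1 / (32 * (real M)\<^sup>2 * (norm q)\<^sup>2) \<le> norm (x - p * inverse q)"
    using assms(2,3)[of n] pq by (auto simp: avoids_rationals_def)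
  then show "1 / (32 * (real M)\<^sup>2) / (norm q)\<^sup>2 \<le> norm (x - p * inverse q)" by simp
qed

text \<open>
  The rationals that a child newly has to avoid have denominators so small that at most one of
  them lies near a given cube, and the ball to be removed around it is smaller than a child.
\<close>
lemma avoids_rationals_children:
  assumes M: "M > 0" and z: "z \<in> lattice" "avoids_rationals M n z"
  shows "M ^ 4 - 256 \<le> card {w \<in> digits M. avoids_rationals M (Suc n) (real M *\<^sub>R z + w)}"
proof -
  define W where "W = {w \<in> digits M. \<not> avoids_rationals M (Suc n) (real M *\<^sub>R z + w)}"
  \<comment> \<open>\<open>R x y\<close> says that \<open>y\<close> is a fraction of admissible
    denominator that may spoil a child containing the point \<open>x\<close> of the parent.\<close>
  define R where "R = (\<lambda>x y. \<exists>p\<in>Hurwitz. \<exists>q\<in>Hurwitz. q \<noteq> 0 \<and> y = p * inverse q \<and>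
    16 * (norm q)\<^sup>2 < real M ^ n \<and> x \<in> grid_cube M n z \<and> dist x y < 1 / (2 * real M ^ Suc n))"
  have bad: "\<exists>x y. x \<in> grid_cube M (Suc n) (real M *\<^sub>R z + w) \<and> R x y" if w: "w \<in> W" for w
  proof -
    from w obtain x p q where x: "x \<in> grid_cube M (Suc n) (real M *\<^sub>R z + w)"
      and pq: "p \<in> Hurwitz" "q \<in> Hurwitz" "q \<noteq> 0" "16 * real M * (norm q)\<^sup>2 < real M ^ Suc n"
        "norm (x - p * inverse q) < 1 / (32 * (real M)\<^sup>2 * (norm q)\<^sup>2)"
      unfolding W_def avoids_rationals_def by (auto simp: not_le)
    have xz: "x \<in> grid_cube M n z" using x grid_cube_child[of M w n z] w M by (auto simp: W_def)
    \<comment> \<open>The parent already avoids smaller denominators, so the offending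
      \<open>q\<close> is new and its radius is at most half the side of a child.\<close>
    have "\<not> 16 * real M * (norm q)\<^sup>2 < real M ^ n"
      using z(2) xz pq unfolding avoids_rationals_def by (meson not_le)
    then have "2 * real M * real M ^ n \<le> 2 * real M * (16 * real M * (norm q)\<^sup>2)"
      by (intro mult_left_mono) auto
    then have "1 / (32 * (real M)\<^sup>2 * (norm q)\<^sup>2) \<le> 1 / (2 * real M ^ Suc n)"
      using M pq(3) by (intro divide_left_mono) (auto simp: power2_eq_square mult_ac)
    then have "dist x (p * inverse q) < 1 / (2 * real M ^ Suc n)" using pq(5) by (simp add: dist_norm)
    moreover have "16 * (norm q)\<^sup>2 < real M ^ n" using pq(4) M by (simp add: mult_ac)
    ultimately show ?thesis using x xz pq unfolding R_def by blast
  qed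
  \<comment> \<open>Two such fractions would be at least \<open>4 / M ^ n\<close> apart, but the
    diameter of the parent and the two radii allow less than \<open>3 / M ^ n\<close>.\<close>
  have unique: "y = y'" if "R x y" "R x' y'" for x y x' y'
  proof (rule ccontr)
    assume ne: "y \<noteq> y'"
    obtain p q where q: "p \<in> Hurwitz" "q \<in> Hurwitz" "q \<noteq> 0" "y = p * inverse q" "16 * (norm q)\<^sup>2 < real M ^ n"
      and x: "x \<in> grid_cube M n z" "dist x y < 1 / (2 * real M ^ Suc n)"
      using \<open>R x y\<close> unfolding R_def by blast
    obtain p' q' where q': "p' \<in> Hurwitz" "q' \<in> Hurwitz" "q' \<noteq> 0" "y' = p' * inverse q'" "16 * (norm q')\<^sup>2 < real M ^ n"
      and x': "x' \<in> grid_cube M n z" "dist x' y' < 1 / (2 * real M ^ Suc n)"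
      using \<open>R x' y'\<close> unfolding R_def by blast
    have "2 * (norm q * norm q') \<le> (norm q)\<^sup>2 + (norm q')\<^sup>2"
      using sum_squares_bound[of "norm q" "norm q'"] by (simp add: mult_ac)
    then have "4 * norm q * norm q' \<le> real M ^ n / 4" using q(5) q'(5) by linarith
    then have "1 / (real M ^ n / 4) \<le> 1 / (4 * norm q * norm q')"
      using M q(3) q'(3) by (intro divide_left_mono) auto
    also have "\<dots> \<le> dist y y'"
      using Hurwitz_fractions_separated[of p q p' q'] q q' ne by simp
    also have "\<dots> \<le> dist x y + dist x x' + dist x' y'"
      by (smt (verit) dist_commute dist_triangle)
    also have "\<dots> < 1 / (2 * real M ^ Suc n) + 2 / real M ^ n + 1 / (2 * real M ^ Suc n)"
      using x x' dist_grid_cube_le[OF M x(1) x'(1)] by linarith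
    also have "\<dots> \<le> 1 / (2 * real M ^ n) + 2 / real M ^ n + 1 / (2 * real M ^ n)"
      using M by (intro add_mono divide_left_mono) auto
    also have "\<dots> = 3 / real M ^ n" using M by (simp add: field_simps)
    finally show False using M by (simp add: divide_less_cancel)
  qed
  have "card W \<le> 256"
  proof (cases "W = {}")
    case False
    then obtain x0 y0 where 0: "R x0 y0" using bad by blast
    \<comment> \<open>All bad children meet this ball around the only relevant fraction. Its
      diameter is at most the side of a child, so at most \<open>4 ^ 4 = 256\<close> children are
      lost.\<close>
    define U where "U = ball y0 (1 / (2 * real M ^ Suc n))"
    have U: "real M ^ Suc n * dist u v \<le> 1" if "u \<in> U" "v \<in> U" for u v
    proof -
      have "dist u v \<le> dist y0 u + dist y0 v" by (metis dist_commute dist_triangle)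
      also have "\<dots> \<le> 1 / (2 * real M ^ Suc n) + 1 / (2 * real M ^ Suc n)"
        using that by (intro add_mono) (auto simp: U_def simp del: power_Suc)
      also have "\<dots> = 1 / real M ^ Suc n" using M by (simp add: field_simps)
      finally show ?thesis using M by (simp add: field_simps)
    qed
    let ?C = "{z'\<in>lattice. grid_cube M (Suc n) z' \<inter> U \<noteq> {}}"
    have "(\<lambda>w. real M *\<^sub>R z + w) ` W \<subseteq> ?C"
    proof (intro image_subsetI CollectI conjI)
      fix w assume w: "w \<in> W"
      then show "real M *\<^sub>R z + w \<in> lattice" using z lattice_child by (auto simp: W_def)
      obtain x y where xy: "x \<in> grid_cube M (Suc n) (real M *\<^sub>R z + w)" "R x y" using bad[OF w] by blast
      then have "y = y0" using unique 0 by blast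
      then have "x \<in> U" using xy(2) by (auto simp: R_def U_def dist_commute)
      then show "grid_cube M (Suc n) (real M *\<^sub>R z + w) \<inter> U \<noteq> {}" using xy(1) by blast
    qed
    then have "card ((\<lambda>w. real M *\<^sub>R z + w) ` W) \<le> card ?C"
      using grid_cubes_meeting_small_set(1)[OF M U] by (intro card_mono) auto
    also have "\<dots> \<le> 4 ^ DIM(quat)"
      using grid_cubes_meeting_small_set(2)[OF M U] .
    finally show ?thesis by (simp add: card_image)
  qed simp
  moreover have "card (digits M - W) = card (digits M :: quat set) - card W"
    by (rule card_Diff_subset) (auto simp: W_def intro: finite_subset[OF _ finite_digits])
  moreover have "digits M - W = {w \<in> digits M. avoids_rationals M (Suc n) (real M *\<^sub>R z + w)}"
    by (auto simp: W_def)
  ultimately show ?thesis by (simp add: card_digits)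
qed

text \<open>\<open>M powr (4 - s) \<ge> 2\<close> gives \<open>M powr s \<le> M ^ 4 / 2\<close>, and
  \<open>M \<ge> 5\<close> gives \<open>M ^ 4 \<ge> 625\<close>, so that half of
  \<open>M ^ 4\<close> exceeds 256.\<close>

lemma exists_branching_number:
  fixes s :: real
  assumes "s < 4"
  obtains M :: nat where "M \<ge> 5" "real M powr s \<le> real (M ^ 4 - 256)"
proof -
  obtain M0 :: nat where M0: "2 powr (1 / (4 - s)) < real M0" using reals_Archimedean2 by blast
  define M where "M = max 5 M0"
  have M: "M \<ge> 5" "2 powr (1 / (4 - s)) \<le> real M" using M0 by (auto simp: M_def)
  have "2 = (2 powr (1 / (4 - s))) powr (4 - s)" using assms by (simp add: powr_powr)
  also have "\<dots> \<le> real M powr (4 - s)" using M(2) assms by (intro powr_mono2) auto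
  finally have "2 * real M powr s \<le> real M powr (4 - s) * real M powr s" by (intro mult_right_mono) auto
  also have "\<dots> = real M ^ 4" using M(1) by (simp add: powr_add[symmetric] powr_realpow[of _ 4, simplified])
  finally have 1: "2 * real M powr s \<le> real M ^ 4" .
  have "(5::real) ^ 4 \<le> real M ^ 4" using M(1) by (intro power_mono) auto
  then have 2: "625 \<le> real M ^ 4" by simp
  then have "real (M ^ 4 - 256) = real M ^ 4 - 256"
    by (subst of_nat_diff) (simp_all flip: of_nat_le_iff[where 'a = real])
  moreover have "real M powr s \<le> real M ^ 4 - 256" using 1 2
    by linarith
  ultimately show ?thesis using M(1) by (intro that[of M]) auto
qed

lemma hausdorff_outer_measure_badly_approximable_neq_0:
  assumes "0 \<le> s" "s < 4"
  shows "hausdorff_outer_measure s {\<xi>. badly_approximable \<xi>} \<noteq> 0"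
proof -
  obtain M :: nat where M: "M \<ge> 5" "real M powr s \<le> real (M ^ 4 - 256)"
    using exists_branching_number[OF \<open>s < 4\<close>] .
  show ?thesis
  proof (rule cantor_hausdorff_outer_measure_neq_0[where M = M and K = "M ^ 4 - 256"
        and good = "avoids_rationals M" and ?z0.0 = 0])
    have "5 ^ 4 \<le> M ^ 4" using M(1) by (intro power_mono) auto
    then show "2 \<le> M ^ 4 - 256" by simp
    \<comment> \<open>The number of kept children outweighs the contraction ratio
      \<open>1 / M\<close> in dimension \<open>s\<close>.\<close>
    have "1 = real M powr s * (1 / real M) powr s"
      using M(1) by (simp add: powr_mult[symmetric])
    also have "\<dots> \<le> real (M ^ 4 - 256) * (1 / real M) powr s"
      using M(2) by (intro mult_right_mono) auto
    finally show "1 \<le> real (M ^ 4 - 256) * (1 / real M) powr s" .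
    show "0 \<le> s" by fact
    show "2 \<le> M" using M(1) by simp
    show "0 \<in> (lattice :: quat set)" by (simp add: lattice_def)
    show "avoids_rationals M 0 0" using M(1) by (simp add: avoids_rationals_0)
    show "M ^ 4 - 256 \<le> card {w \<in> digits M. avoids_rationals M (Suc n) (real M *\<^sub>R z + w)}"
      if "z \<in> lattice" "avoids_rationals M n z" for n z
      using avoids_rationals_children[OF _ that] M(1) by simp
    show "x \<in> {\<xi>. badly_approximable \<xi>}"
      if "\<And>n. avoids_rationals M n (z n)" "\<And>n. x \<in> grid_cube M n (z n)" for z x
      using avoids_rationals_limit[OF _ that] M(1) by simp
  qed
qed

theorem theorem6p7:
  shows "{\<xi>. badly_approximable \<xi>} \<in> null_sets lebesgue \<and>
         hausdorff_dim {\<xi>. badly_approximable \<xi>} = 4"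
proof
  show null: "{\<xi>. badly_approximable \<xi>} \<in> null_sets lebesgue"
    by (rule badly_approximable_null_sets)
  show "hausdorff_dim {\<xi>. badly_approximable \<xi>} = 4"
  proof (rule antisym)
    have "hausdorff_outer_measure 4 {\<xi>. badly_approximable \<xi>} = 0"
      using hausdorff_outer_measure_null_sets[OF null] by simp
    then show "hausdorff_dim {\<xi>. badly_approximable \<xi>} \<le> 4"
      unfolding hausdorff_dim_def by (intro INF_lower2[of 4]) auto
    show "4 \<le> hausdorff_dim {\<xi>. badly_approximable \<xi>}"
      unfolding hausdorff_dim_def
    proof (rule INF_greatest)
      fix s assume "s \<in> {s. 0 \<le> s \<and> hausdorff_outer_measure s {\<xi>. badly_approximable \<xi>} = 0}"
      then have "4 \<le> s" using hausdorff_outer_measure_badly_approximable_neq_0[of s] by force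
      then show "4 \<le> ereal s" by simp
    qed
  qed
qed

end
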